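(* Let $q$ be a prime power, let $n \geq 20$ be an integer and let $S \subset \mathbb{F}_q^n$. Let $\tau > 1$ be a real number and $\delta \in (0, 1/10)$ such that $$q \geq \max\left(\frac{n(1+\tau)}{(\tau - \sqrt{\tau})^2\delta^2},\, n\right).$$ Suppose $q^r < |S| \leq q^{r+1}$ for some integer $4 \leq r \leq n-1$, and let $t = r-3$. Then at least a $(1-\delta)$-fraction of all surjective linear maps $L : \mathbb{F}_q^n \to \mathbb{F}_q^t$ are such that $L(U_S)$ is $\tau/q^t$-close to the uniform distribution in the $\ell_\infty$ norm, i.e. $|\Pr[L(U_S)=y] - q^{-t}| \leq \tau q^{-t}$ for all $y \in \mathbb{F}_q^t$.
   Context: $U_S$ denotes a random variable distributed uniformly on the finite set $S$. A random variable $X$ on a finite set $Y$ is $\epsilon$-close to uniform in the $\ell_\infty$ norm if $|\Pr[X=y] - 1/|Y|| \leq \epsilon$ for every $y \in Y$. *)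

theory Defs
  imports Complex_Main
begin

definition vecs :: "nat \<Rightarrow> (nat \<Rightarrow> 'a::zero) set" where
  "vecs n = {v. \<forall>i\<ge>n. v i = 0}"

text \<open>Linear maps F_q^n -> F_q^t, represented by their t x n matrices
  (entries zero outside the index ranges, so the representation is unique).\<close>
definition mats :: "nat \<Rightarrow> nat \<Rightarrow> (nat \<Rightarrow> nat \<Rightarrow> 'a::zero) set" where
  "mats t n = {M. \<forall>i j. (t \<le> i \<or> n \<le> j) \<longrightarrow> M i j = 0}"

definition mat_apply :: "nat \<Rightarrow> nat \<Rightarrow> (nat \<Rightarrow> nat \<Rightarrow> 'a::comm_semiring_1) \<Rightarrow> (nat \<Rightarrow> 'a) \<Rightarrow> (nat \<Rightarrow> 'a)" where
  "mat_apply t n M v = (\<lambda>i. if i < t then (\<Sum>j<n. M i j * v j) else 0)"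

definition surj_lin_maps :: "nat \<Rightarrow> nat \<Rightarrow> (nat \<Rightarrow> nat \<Rightarrow> 'a::comm_semiring_1) set" where
  "surj_lin_maps t n = {M \<in> mats t n. mat_apply t n M ` vecs n = vecs t}"

definition push_unif :: "'b set \<Rightarrow> ('b \<Rightarrow> 'c) \<Rightarrow> 'c \<Rightarrow> real" where
  "push_unif S L y = real (card {x \<in> S. L x = y}) / real (card S)"

definition linf_close_unif :: "('c \<Rightarrow> real) \<Rightarrow> 'c set \<Rightarrow> real \<Rightarrow> bool" where
  "linf_close_unif p Y eps \<longleftrightarrow> (\<forall>y\<in>Y. \<bar>p y - 1 / real (card Y)\<bar> \<le> eps)"

end

theory Submission
  imports Defs "HOL-Computational_Algebra.Polynomial" "HOL-Library.FuncSet"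
begin

text \<open>Since \<open>\<tau> > 1\<close>, only fibres that are too heavy matter. Put \<open>t = r - 3\<close> and suppose that
  \<open>L\<close> has a fibre \<open>A\<close> with more than \<open>(1 + \<tau>) |S| / q^t > (1 + \<tau>) q^3\<close> points of \<open>S\<close>. By
  Chebyshev's inequality, two further random linear forms spread \<open>A\<close> so evenly over the \<open>q^2\<close>
  points of a plane that almost all of these points lie in the set \<open>K\<close> of points of
  \<open>F^(t + 2)\<close> with at least \<open>(1 + sqrt \<tau>)\<close> times the mean number of preimages. Thus, if many
  \<open>L\<close> are bad, then for a typical \<open>M : F^n \<rightarrow> F^(t + 2)\<close> the set \<open>K\<close> almost contains a plane in
  many directions. A Kakeya theorem for planes bounds \<open>K\<close> from below by a constant times the
  proportion of these directions, whereas the second moment of the fibres of \<open>M\<close> shows that \<open>K\<close>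
  has density only \<open>O(1 / (q \<tau>))\<close> on average.

  The Kakeya theorem is proved by the polynomial method with multiplicities. The top degree form
  of a polynomial that vanishes to high order on \<open>K\<close> vanishes to high order at the point
  \<open>b\<^sub>0 + X b\<^sub>1\<close> over the ring \<open>F[X]\<close> for every plane direction \<open>(b\<^sub>0, b\<^sub>1)\<close>. As these points lie in a
  grid with side \<open>q^2\<close> instead of \<open>q\<close>, degrees up to about \<open>q^2\<close> times the order of vanishing are
  excluded, and the bound loses only a constant factor for \<open>q\<close> at least the dimension. A
  small proportion of directions is first raised to one half by shearing \<open>K\<close>.\<close>

section \<open>Hasse derivatives and the Schwartz-Zippel lemma with multiplicities\<close>

text \<open>The default 0 outside the index set makes the representation unique and lets functions
  with disjoint index sets be combined by addition. The same encoding serves exponent vectors, grid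
  points and, through \<open>vecs_eq_funs\<close>, vectors.\<close>

definition funs :: "nat set \<Rightarrow> 'b::zero set \<Rightarrow> (nat \<Rightarrow> 'b) set" where
  "funs I A = {f. (\<forall>i\<in>I. f i \<in> A) \<and> (\<forall>i. i \<notin> I \<longrightarrow> f i = 0)}"

lemma funs_empty [simp]: "funs {} A = {\<lambda>_. 0}"
  by (auto simp: funs_def)

lemma funs_upd_bij:
  assumes "i \<notin> I"
  shows "bij_betw (\<lambda>(f, a). f(i := a)) (funs I A \<times> A) (funs (insert i I) A)"
  by (rule bij_betw_byWitness[where f' = "\<lambda>f. (f(i := 0), f i)"])
    (use assms in \<open>auto simp: funs_def fun_eq_iff\<close>)

lemma sum_funs_insert:
  assumes "i \<notin> I"
  shows "sum g (funs (insert i I) A) = (\<Sum>f\<in>funs I A. \<Sum>a\<in>A. g (f(i := a)))"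
proof -
  have "sum g (funs (insert i I) A) = (\<Sum>(f, a)\<in>funs I A \<times> A. g (f(i := a)))"
    using sum.reindex_bij_betw[OF funs_upd_bij[OF assms, of A], of g]
    by (simp add: case_prod_unfold)
  then show ?thesis by (simp add: sum.cartesian_product)
qed

lemma finite_funs: "finite I \<Longrightarrow> finite A \<Longrightarrow> finite (funs I A)"
proof (induction I rule: finite_induct)
  case (insert i I)
  then show ?case using bij_betw_finite[OF funs_upd_bij[of i I A]] by auto
qed simp

lemma card_funs: "finite I \<Longrightarrow> card (funs I A) = card A ^ card I"
proof (induction I rule: finite_induct)
  case (insert i I)
  then show ?case
    using bij_betw_same_card[OF funs_upd_bij[of i I A]] by (simp add: card_cartesian_product mult.commute)
qed simp

lemma sum_funs_union:
  fixes A :: "'b::monoid_add set"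
  assumes "I \<inter> J = {}"
  shows "sum g (funs (I \<union> J) A) = (\<Sum>f\<in>funs I A. \<Sum>h\<in>funs J A. g (\<lambda>i. f i + h i))"
proof -
  have "bij_betw (\<lambda>(f, h) i. f i + h i) (funs I A \<times> funs J A) (funs (I \<union> J) A)"
    by (rule bij_betw_byWitness[where f' = "\<lambda>f. ((\<lambda>i. if i \<in> I then f i else 0), (\<lambda>i. if i \<in> J then f i else 0))"])
      (use assms in \<open>auto simp: funs_def fun_eq_iff\<close>)
  from sum.reindex_bij_betw[OF this, of g]
  have "sum g (funs (I \<union> J) A) = (\<Sum>(f, h)\<in>funs I A \<times> funs J A. g (\<lambda>i. f i + h i))"
    by (simp add: case_prod_unfold)
  then show ?thesis by (simp add: sum.cartesian_product)
qed

lemma prod_sum_funs: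
  fixes g :: "nat \<Rightarrow> 'b::zero \<Rightarrow> 'c::comm_semiring_1"
  assumes "finite I"
  shows "(\<Prod>i\<in>I. \<Sum>a\<in>A. g i a) = (\<Sum>f\<in>funs I A. \<Prod>i\<in>I. g i (f i))"
  using assms
proof (induction I rule: finite_induct)
  case (insert i I)
  have "(\<Prod>k\<in>I. g k ((f(i := a)) k)) = (\<Prod>k\<in>I. g k (f k))" for f :: "nat \<Rightarrow> 'b" and a
    by (rule prod.cong) (use insert in auto)
  with insert show ?case
    by (simp add: sum_funs_insert sum_product sum.swap[of _ A])
qed simp

section \<open>Multivariate polynomials and their Taylor expansion\<close>

abbreviation box :: "nat set \<Rightarrow> nat \<Rightarrow> (nat \<Rightarrow> nat) set" where
  "box I N \<equiv> funs I {..N}"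

text \<open>A polynomial is given by its coefficient function; only exponents up to \<open>N\<close>
  in each variable are read, so that the sum is finite.\<close>

definition poly_val :: "nat set \<Rightarrow> nat \<Rightarrow> ((nat \<Rightarrow> nat) \<Rightarrow> 'r::comm_ring_1) \<Rightarrow> (nat \<Rightarrow> 'r) \<Rightarrow> 'r" where
  "poly_val I N p x = (\<Sum>\<alpha>\<in>box I N. p \<alpha> * (\<Prod>i\<in>I. x i ^ \<alpha> i))"

text \<open>The coefficient of \<open>z^j\<close> in the expansion at \<open>x + z\<close>. Binomial
  coefficients replace iterated derivatives, which lose information in positive characteristic. The
  truncated exponent is harmless, since the binomial coefficient vanishes for
  \<open>j i > \<alpha> i\<close>.\<close>

definition hasse ::
    "nat set \<Rightarrow> nat \<Rightarrow> ((nat \<Rightarrow> nat) \<Rightarrow> 'r::comm_ring_1) \<Rightarrow> (nat \<Rightarrow> 'r) \<Rightarrow> (nat \<Rightarrow> nat) \<Rightarrow> 'r" where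
  "hasse I N p x j = (\<Sum>\<alpha>\<in>box I N. p \<alpha> * (\<Prod>i\<in>I. of_nat (\<alpha> i choose j i) * x i ^ (\<alpha> i - j i)))"

lemma power_add_binomial_upto:
  fixes x y :: "'r::comm_ring_1"
  assumes "k \<le> N"
  shows "(x + y) ^ k = (\<Sum>b\<le>N. of_nat (k choose b) * x ^ (k - b) * y ^ b)"
proof -
  have "(x + y) ^ k = (y + x) ^ k" by (simp add: add.commute)
  also have "\<dots> = (\<Sum>b\<le>k. of_nat (k choose b) * y ^ b * x ^ (k - b))"
    by (rule binomial_ring)
  also have "\<dots> = (\<Sum>b\<le>N. of_nat (k choose b) * y ^ b * x ^ (k - b))"
    by (rule sum.mono_neutral_left) (use assms in \<open>auto simp: not_le binomial_eq_0\<close>)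
  finally show ?thesis by (simp add: mult_ac)
qed

lemma taylor:
  assumes "finite I"
  shows "poly_val I N p (\<lambda>i. a i + z i) = (\<Sum>j\<in>box I N. hasse I N p a j * (\<Prod>i\<in>I. z i ^ j i))"
proof -
  have "poly_val I N p (\<lambda>i. a i + z i) = (\<Sum>\<alpha>\<in>box I N. p \<alpha> *
      (\<Prod>i\<in>I. \<Sum>b\<le>N. of_nat (\<alpha> i choose b) * a i ^ (\<alpha> i - b) * z i ^ b))"
    unfolding poly_val_def
    by (intro sum.cong refl arg_cong2[where f = "(*)"] prod.cong power_add_binomial_upto)
      (auto simp: funs_def)
  also have "\<dots> = (\<Sum>\<alpha>\<in>box I N. \<Sum>j\<in>box I N. p \<alpha> *
      (\<Prod>i\<in>I. of_nat (\<alpha> i choose j i) * a i ^ (\<alpha> i - j i)) * (\<Prod>i\<in>I. z i ^ j i))"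
    by (simp add: prod_sum_funs[OF assms] sum_distrib_left prod.distrib mult.assoc)
  also have "\<dots> = (\<Sum>j\<in>box I N. hasse I N p a j * (\<Prod>i\<in>I. z i ^ j i))"
    unfolding hasse_def by (subst sum.swap) (simp add: sum_distrib_right)
  finally show ?thesis .
qed

lemma poly_val_insert:
  assumes "finite I" "i \<notin> I"
  shows "poly_val (insert i I) N p x = (\<Sum>k\<le>N. poly_val I N (\<lambda>\<alpha>. p (\<alpha>(i := k))) x * x i ^ k)"
proof -
  have *: "(\<Prod>l\<in>I. x l ^ (\<alpha>(i := k)) l) = (\<Prod>l\<in>I. x l ^ \<alpha> l)" for \<alpha> :: "nat \<Rightarrow> nat" and k
    by (rule prod.cong) (use assms in auto)
  show ?thesis
    unfolding poly_val_def
    by (subst sum_funs_insert[OF assms(2)], subst prod.insert[OF assms], subst *, subst sum.swap)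
      (simp add: sum_distrib_right sum_distrib_left mult_ac)
qed

lemma hasse_insert:
  assumes "finite I" "i \<notin> I"
  shows "hasse (insert i I) N p (x(i := a)) (j(i := b)) =
    (\<Sum>k\<le>N. of_nat (k choose b) * a ^ (k - b) * hasse I N (\<lambda>\<alpha>. p (\<alpha>(i := k))) x j)"
proof -
  have *: "(\<Prod>l\<in>I. of_nat ((\<alpha>(i := k)) l choose (j(i := b)) l) * (x(i := a)) l ^ ((\<alpha>(i := k)) l - (j(i := b)) l))
      = (\<Prod>l\<in>I. of_nat (\<alpha> l choose j l) * x l ^ (\<alpha> l - j l))" for \<alpha> :: "nat \<Rightarrow> nat" and k
    by (rule prod.cong) (use assms in auto)
  show ?thesis
    unfolding hasse_def
    by (subst sum_funs_insert[OF assms(2)], subst prod.insert[OF assms], subst *, subst sum.swap)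
      (simp add: sum_distrib_left mult_ac)
qed

text \<open>A binomial coefficient vanishes unless \<open>j \<le> \<alpha>\<close> in every
  coordinate, and then \<open>\<alpha> \<noteq> j\<close> would give a total degree above that of
  \<open>j\<close>. So only the term of \<open>j\<close> itself survives.\<close>

lemma hasse_top:
  assumes "finite I" "j \<in> box I N"
    and "\<And>\<alpha>. \<alpha> \<in> box I N \<Longrightarrow> p \<alpha> \<noteq> 0 \<Longrightarrow> sum \<alpha> I \<le> sum j I"
  shows "hasse I N p x j = p j"
proof -
  have "p \<alpha> * (\<Prod>i\<in>I. of_nat (\<alpha> i choose j i) * x i ^ (\<alpha> i - j i)) = (if \<alpha> = j then p j else 0)"
    if \<alpha>: "\<alpha> \<in> box I N" for \<alpha>
  proof (cases "\<exists>i\<in>I. \<alpha> i < j i")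
    case True
    then obtain i where "i \<in> I" "\<alpha> i < j i" by blast
    then have "(\<Prod>i\<in>I. of_nat (\<alpha> i choose j i) * x i ^ (\<alpha> i - j i)) = 0"
      using assms(1) by (intro prod_zero) (auto intro!: bexI[of _ i] simp: binomial_eq_0)
    with \<open>\<alpha> i < j i\<close> show ?thesis by auto
  next
    case False
    show ?thesis
    proof (cases "\<alpha> = j")
      case False
      have "\<exists>i\<in>I. \<alpha> i \<noteq> j i"
        using False \<alpha> assms(2) by (fastforce simp: funs_def fun_eq_iff)
      then obtain i where "i \<in> I" "j i < \<alpha> i"
        using \<open>\<not> (\<exists>i\<in>I. \<alpha> i < j i)\<close> by (metis linorder_neqE_nat)
      then have "sum j I < sum \<alpha> I"
        using \<open>\<not> (\<exists>i\<in>I. \<alpha> i < j i)\<close> assms(1) by (intro sum_strict_mono_ex1) (auto simp: not_less)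
      then show ?thesis using assms(3)[OF \<alpha>] False by fastforce
    qed simp
  qed
  then have "hasse I N p x j = (\<Sum>\<alpha>\<in>box I N. if \<alpha> = j then p j else 0)"
    unfolding hasse_def by (intro sum.cong) auto
  also have "\<dots> = p j"
    using assms(1,2) by (simp add: finite_funs)
  finally show ?thesis .
qed

text \<open>An exponent of maximal total degree in the support satisfies \<open>hasse_top\<close>.
  Thus a nonzero polynomial has finite multiplicity at every point.\<close>

lemma exists_hasse_nonzero:
  assumes "finite I" "\<exists>\<alpha>\<in>box I N. p \<alpha> \<noteq> 0"
  shows "\<exists>j\<in>box I N. hasse I N p x j \<noteq> 0"
proof -
  let ?A = "{\<alpha> \<in> box I N. p \<alpha> \<noteq> 0}"
  have fin: "finite ((\<lambda>\<alpha>. sum \<alpha> I) ` ?A)"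
    using assms(1) by (simp add: finite_funs)
  have "Max ((\<lambda>\<alpha>. sum \<alpha> I) ` ?A) \<in> (\<lambda>\<alpha>. sum \<alpha> I) ` ?A"
    using fin assms(2) by (intro Max_in) auto
  then obtain j where j: "j \<in> ?A" "sum j I = Max ((\<lambda>\<alpha>. sum \<alpha> I) ` ?A)" by auto
  have "hasse I N p x j = p j"
    using assms(1) j fin by (intro hasse_top) auto
  with j show ?thesis by (intro bexI[of _ j]) auto
qed

section \<open>Orders of vanishing and the Schwartz-Zippel bound\<close>

lemma pcompose_power: "pcompose (p ^ k) q = pcompose p q ^ k"
  by (induction k) (simp_all only: power_0 power_Suc pcompose_1 pcompose_mult)

lemma coeff_pcompose_shift:
  fixes c :: "nat \<Rightarrow> 'r::comm_ring_1"
  shows "coeff (pcompose (\<Sum>k\<le>N. monom (c k) k) [:a, 1:]) b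
    = (\<Sum>k\<le>N. of_nat (k choose b) * a ^ (k - b) * c k)"
proof -
  have *: "pcompose (monom e k) [:a, 1:] = smult e ([:a, 1:] ^ k)" for e :: 'r and k
    by (simp add: monom_altdef pcompose_smult pcompose_power pcompose_pCons)
  have "coeff ([:a, 1:] ^ k) b = of_nat (k choose b) * a ^ (k - b)" for k
  proof (cases "b \<le> k")
    case True
    then show ?thesis by (simp add: coeff_linear_poly_power mult.commute)
  next
    case False
    have "degree ([:a, 1:] ^ k) \<le> k"
      using degree_power_le[of "[:a, 1:]" k] by simp
    then show ?thesis using False by (simp add: coeff_eq_0 binomial_eq_0)
  qed
  then show ?thesis by (simp add: pcompose_sum coeff_sum * mult_ac)
qed

text \<open>\<open>X^e\<close> divides \<open>h(X + a)\<close>; substituting \<open>X - a\<close>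
  for \<open>X\<close> turns this into \<open>(X - a)^e\<close> dividing \<open>h\<close>.\<close>

lemma order_ge_of_shift:
  fixes h :: "'r::idom poly"
  assumes "h \<noteq> 0" "\<And>b. b < e \<Longrightarrow> coeff (pcompose h [:a, 1:]) b = 0"
  shows "e \<le> order a h"
proof -
  have "monom 1 e dvd pcompose h [:a, 1:]"
    using assms(2) by (simp add: monom_1_dvd_iff')
  then obtain g where g: "pcompose h [:a, 1:] = [:0, 1:] ^ e * g"
    by (auto simp: monom_altdef)
  have "h = pcompose (pcompose h [:a, 1:]) [:-a, 1:]"
    by (simp add: pcompose_assoc[symmetric] pcompose_pCons)
  also have "\<dots> = pcompose ([:0, 1:] ^ e) [:-a, 1:] * pcompose g [:-a, 1:]"
    by (simp add: g pcompose_mult)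
  also have "pcompose ([:0, 1:] ^ e) [:-a, 1:] = [:-a, 1:] ^ e"
    by (simp add: pcompose_power pcompose_pCons)
  finally have "[:-a, 1:] ^ e dvd h" by (metis dvd_triv_left)
  then show ?thesis using assms(1) by (simp add: order_divides)
qed

lemma sum_order_le_degree':
  fixes h :: "'r::idom poly"
  assumes "h \<noteq> 0" "finite T"
  shows "(\<Sum>a\<in>T. order a h) \<le> degree h"
proof -
  have "(\<Sum>a\<in>T. order a h) = (\<Sum>a\<in>T \<inter> {x. poly h x = 0}. order a h)"
    by (rule sum.mono_neutral_right) (use assms in \<open>auto simp: order_0I\<close>)
  also have "\<dots> \<le> (\<Sum>a | poly h a = 0. order a h)"
    by (rule sum_mono2) (use assms in \<open>auto simp: poly_roots_finite\<close>)
  also have "\<dots> \<le> degree h" using sum_order_le_degree[OF assms(1)] .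
  finally show ?thesis .
qed

text \<open>Regard \<open>p\<close> as a polynomial in one variable, of degree \<open>k0\<close>,
  whose leading coefficient has multiplicity \<open>\<mu> x\<close> at a point \<open>x\<close> of
  the smaller grid. A suitable derivative of order \<open>\<mu> x\<close> in the other variables
  leaves a nonzero univariate polynomial of degree at most \<open>k0\<close> that still vanishes at
  \<open>a\<close> to order \<open>M - \<mu> x\<close>. Its roots bound the multiplicities on one
  line, and the induction hypothesis bounds the sum of the \<open>\<mu> x\<close>. The factor
  \<open>card T\<close> on the left avoids the exponent \<open>card I - 1\<close>.\<close>

theorem schwartz_zippel_multiplicity:
  fixes p :: "(nat \<Rightarrow> nat) \<Rightarrow> 'r::idom"
  assumes "finite I" "finite T"
    and "\<And>\<alpha>. \<alpha> \<in> box I N \<Longrightarrow> p \<alpha> \<noteq> 0 \<Longrightarrow> sum \<alpha> I \<le> D"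
    and "\<exists>\<alpha>\<in>box I N. p \<alpha> \<noteq> 0"
    and "\<And>x j. x \<in> funs I T \<Longrightarrow> j \<in> box I N \<Longrightarrow> sum j I < M x \<Longrightarrow> hasse I N p x j = 0"
  shows "card T * (\<Sum>x\<in>funs I T. M x) \<le> D * card T ^ card I"
  using assms(1,3-)
proof (induction I arbitrary: p D M rule: finite_induct)
  case empty
  \<comment> \<open>Without variables \<open>hasse\<close> is the coefficient itself, which is
    nonzero; a positive \<open>M\<close> would force it to vanish.\<close>
  then have "M (\<lambda>_. 0) = 0"
    using empty.prems(3)[of "\<lambda>_. 0" "\<lambda>_. 0"] by (fastforce simp: hasse_def)
  then show ?case by simp
next
  case (insert i I)
  define P where "P k = (\<lambda>\<alpha>. p (\<alpha>(i := k)))" for k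
  define k0 where "k0 = Max {k. k \<le> N \<and> (\<exists>\<alpha>\<in>box I N. P k \<alpha> \<noteq> 0)}"
  have fin: "finite {k. k \<le> N \<and> (\<exists>\<alpha>\<in>box I N. P k \<alpha> \<noteq> 0)}" by simp
  obtain \<beta> where "\<beta> \<in> box (insert i I) N" "p \<beta> \<noteq> 0" using insert.prems(2) by blast
  then have "\<beta> i \<le> N" "\<beta>(i := 0) \<in> box I N" "P (\<beta> i) (\<beta>(i := 0)) \<noteq> 0"
    using insert.hyps by (auto simp: funs_def P_def)
  then have "{k. k \<le> N \<and> (\<exists>\<alpha>\<in>box I N. P k \<alpha> \<noteq> 0)} \<noteq> {}" by blast
  from Max_in[OF fin this] have k0: "k0 \<le> N" "\<exists>\<alpha>\<in>box I N. P k0 \<alpha> \<noteq> 0"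
    unfolding k0_def by auto
  have above: "P k \<alpha> = 0" if "k \<le> N" "k0 < k" "\<alpha> \<in> box I N" for k \<alpha>
    using Max_ge[OF fin, of k] that unfolding k0_def by (metis (mono_tags, lifting) mem_Collect_eq not_less)
  have up: "\<alpha>(i := k) \<in> box (insert i I) N" if "\<alpha> \<in> box I N" "k \<le> N" for \<alpha> k
    using that by (auto simp: funs_def)
  have sum_up: "sum (\<alpha>(i := k)) (insert i I) = k + sum \<alpha> I" for \<alpha> :: "nat \<Rightarrow> nat" and k
    using insert.hyps by (simp add: sum.insert) (rule sum.cong, auto)
  have deg: "k0 + sum \<alpha> I \<le> D" if "\<alpha> \<in> box I N" "P k0 \<alpha> \<noteq> 0" for \<alpha>
    using insert.prems(1)[OF up[OF that(1) k0(1)]] that(2) unfolding P_def sum_up by blast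
  then have "k0 \<le> D" using k0(2) by fastforce
  \<comment> \<open>The least order of a derivative of the leading coefficient that is nonzero at
    \<open>x\<close> is the multiplicity of that coefficient at \<open>x\<close>.\<close>
  have "\<exists>j. j \<in> box I N \<and> hasse I N (P k0) x j \<noteq> 0 \<and>
      (\<forall>j'\<in>box I N. sum j' I < sum j I \<longrightarrow> hasse I N (P k0) x j' = 0)" for x
    using ex_has_least_nat[of "\<lambda>j. j \<in> box I N \<and> hasse I N (P k0) x j \<noteq> 0" _ "\<lambda>j. sum j I"]
      exists_hasse_nonzero[OF insert.hyps(1) k0(2), of x] by (metis not_less)
  then obtain J where J: "\<And>x. J x \<in> box I N" "\<And>x. hasse I N (P k0) x (J x) \<noteq> 0"
    "\<And>x j'. j' \<in> box I N \<Longrightarrow> sum j' I < sum (J x) I \<Longrightarrow> hasse I N (P k0) x j' = 0"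
    by metis
  define \<mu> where "\<mu> x = sum (J x) I" for x
  have IH: "card T * (\<Sum>x\<in>funs I T. \<mu> x) \<le> (D - k0) * card T ^ card I"
    by (rule insert.IH[of "P k0"]) (use deg k0(2) J(3) in \<open>fastforce simp: \<mu>_def\<close>)+
  have line: "(\<Sum>a\<in>T. M (x(i := a))) \<le> card T * \<mu> x + k0" if x: "x \<in> funs I T" for x
  proof -
    define c where "c k = hasse I N (P k) x (J x)" for k
    define h where "h = (\<Sum>k\<le>N. monom (c k) k)"
    have coeff_h: "coeff h k = (if k \<le> N then c k else 0)" for k
      by (simp add: h_def coeff_sum coeff_monom)
    have "coeff h k0 \<noteq> 0" using J(2) k0(1) by (simp add: coeff_h c_def)
    then have "h \<noteq> 0" by auto
    have "degree h \<le> k0"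
    proof (rule degree_le, intro allI impI)
      fix k assume "k0 < k"
      then show "coeff h k = 0"
        using above[of k] by (auto simp: coeff_h c_def hasse_def)
    qed
    have "M (x(i := a)) - \<mu> x \<le> order a h" if "a \<in> T" for a
    proof (rule order_ge_of_shift[OF \<open>h \<noteq> 0\<close>])
      fix b assume b: "b < M (x(i := a)) - \<mu> x"
      show "coeff (pcompose h [:a, 1:]) b = 0"
      proof (cases "b \<le> N")
        case True
        \<comment> \<open>The combined derivative has order \<open>\<mu> x + b\<close>, which is
          below \<open>M (x(i := a))\<close>.\<close>
        have "hasse (insert i I) N p (x(i := a)) ((J x)(i := b)) = 0"
        proof (rule insert.prems(3))
          show "x(i := a) \<in> funs (insert i I) T" using x that by (auto simp: funs_def)
          show "(J x)(i := b) \<in> box (insert i I) N" using J(1) True by (rule up)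
          show "sum ((J x)(i := b)) (insert i I) < M (x(i := a))"
            using b unfolding sum_up \<mu>_def by linarith
        qed
        then show ?thesis
          unfolding h_def coeff_pcompose_shift c_def P_def
          by (simp add: hasse_insert[OF insert.hyps])
      next
        case False
        then show ?thesis unfolding h_def coeff_pcompose_shift
          by (intro sum.neutral) (auto simp: binomial_eq_0)
      qed
    qed
    then have "(\<Sum>a\<in>T. M (x(i := a)) - \<mu> x) \<le> (\<Sum>a\<in>T. order a h)"
      by (rule sum_mono)
    also have "\<dots> \<le> k0"
      using sum_order_le_degree'[OF \<open>h \<noteq> 0\<close> assms(2)] \<open>degree h \<le> k0\<close> by linarith
    finally have "(\<Sum>a\<in>T. M (x(i := a)) - \<mu> x) \<le> k0" .
    \<comment> \<open>Subtraction is truncated, so in general only this inequality holds.\<close>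
    moreover have "(\<Sum>a\<in>T. M (x(i := a))) \<le> (\<Sum>a\<in>T. (M (x(i := a)) - \<mu> x) + \<mu> x)"
      by (rule sum_mono) simp
    ultimately show ?thesis by (simp add: sum.distrib)
  qed
  have "card T * (\<Sum>x\<in>funs (insert i I) T. M x)
      = card T * (\<Sum>x\<in>funs I T. \<Sum>a\<in>T. M (x(i := a)))"
    using insert.hyps by (simp add: sum_funs_insert)
  also have "\<dots> \<le> card T * (\<Sum>x\<in>funs I T. card T * \<mu> x + k0)"
    by (intro mult_left_mono sum_mono line) auto
  also have "\<dots> = card T * (card T * (\<Sum>x\<in>funs I T. \<mu> x) + k0 * card T ^ card I)"
    using insert.hyps by (simp add: sum.distrib sum_distrib_left card_funs)
  also have "\<dots> \<le> card T * ((D - k0) * card T ^ card I + k0 * card T ^ card I)"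
    using IH by (intro mult_left_mono add_right_mono) auto
  also have "\<dots> = D * card T ^ card (insert i I)"
    using insert.hyps \<open>k0 \<le> D\<close> by (simp add: mult_ac flip: add_mult_distrib)
  finally show ?case .
qed

text \<open>Fixing all variables but one gives a univariate polynomial with infinitely many roots.
  The lemma is applied over \<open>F[X]\<close>, which is infinite although \<open>F\<close> is
  not.\<close>

lemma poly_val_eq_0_imp:
  fixes p :: "(nat \<Rightarrow> nat) \<Rightarrow> 'r::idom"
  assumes "finite I" "infinite (UNIV :: 'r set)" "\<And>x. poly_val I N p x = 0" "\<alpha> \<in> box I N"
  shows "p \<alpha> = 0"
  using assms(1,3,4)
proof (induction I arbitrary: p \<alpha> rule: finite_induct)
  case empty
  then show ?case by (simp add: poly_val_def)
next
  case (insert i I)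
  have "poly_val I N (\<lambda>\<alpha>. p (\<alpha>(i := k))) x = 0" if "k \<le> N" for k x
  proof -
    define h where "h = (\<Sum>k\<le>N. monom (poly_val I N (\<lambda>\<alpha>. p (\<alpha>(i := k))) x) k)"
    have "poly h a = 0" for a
    proof -
      have "poly_val I N q (x(i := a)) = poly_val I N q x" for q
        unfolding poly_val_def using insert.hyps by (intro sum.cong refl arg_cong2[where f = "(*)"] prod.cong) auto
      then show ?thesis
        using insert.prems(1)[of "x(i := a)"]
        by (simp add: h_def poly_sum poly_monom poly_val_insert[OF insert.hyps] fun_upd_same
            del: fun_upd_apply)
    qed
    then have "{a. poly h a = 0} = UNIV" by auto
    then have "h = 0" using poly_roots_finite[of h] assms(2) by auto
    then have "coeff h k = 0" by simp
    then show ?thesis using that by (simp add: h_def coeff_sum coeff_monom)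
  qed
  then have "p ((\<alpha>(i := 0))(i := \<alpha> i)) = 0"
    using insert.prems(2) insert.hyps by (intro insert.IH[of "\<lambda>\<beta>. p (\<beta>(i := \<alpha> i))"]) (auto simp: funs_def)
  then show ?case by simp
qed

section \<open>Affine substitutions\<close>

lemma poly_eqI_infinite:
  fixes g h :: "'r::idom poly"
  assumes "infinite (UNIV :: 'r set)" "\<And>s. poly g s = poly h s"
  shows "g = h"
proof (rule ccontr)
  assume "g \<noteq> h"
  then have "finite {s. poly (g - h) s = 0}" by (intro poly_roots_finite) simp
  moreover have "{s. poly (g - h) s = 0} = UNIV" using assms(2) by simp
  ultimately show False using assms(1) by simp
qed

text \<open>The restriction to the line \<open>a + s * v\<close> as a polynomial in
  \<open>s\<close>. Its coefficient of \<open>s^k\<close> is the homogeneous part of degree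
  \<open>k\<close> of the Taylor expansion at \<open>a\<close>, evaluated at
  \<open>v\<close>.\<close>

definition ray_poly where
  "ray_poly I N p a v = (\<Sum>j\<in>box I N. monom (hasse I N p a j * (\<Prod>i\<in>I. v i ^ j i)) (sum j I))"

lemma poly_ray_poly:
  assumes "finite I"
  shows "poly (ray_poly I N p a v) s = poly_val I N p (\<lambda>i. a i + s * v i)"
  by (simp add: taylor[OF assms] ray_poly_def poly_sum poly_monom power_mult_distrib prod.distrib
      power_sum mult_ac)

lemma coeff_ray_poly:
  "coeff (ray_poly I N p a v) k
    = poly_val I N (\<lambda>j. if sum j I = k then hasse I N p a j else 0) v"
  unfolding ray_poly_def poly_val_def coeff_sum by (intro sum.cong) auto

text \<open>Over an infinite domain, vanishing to order \<open>m\<close> is tested along lines; in this form it is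
  visibly invariant under affine substitutions.\<close>

definition vanishes_to_order where
  "vanishes_to_order f a m \<longleftrightarrow>
    (\<forall>v. \<exists>g :: 'r::comm_ring_1 poly. \<forall>s. f (\<lambda>i::nat. a i + s * v i) = s ^ m * poly g s)"

lemma vanishes_to_order_if_hasse:
  assumes "finite I" "\<And>j. j \<in> box I N \<Longrightarrow> sum j I < m \<Longrightarrow> hasse I N p a j = 0"
  shows "vanishes_to_order (poly_val I N p) a m"
  unfolding vanishes_to_order_def
proof
  fix v
  have "coeff (ray_poly I N p a v) k = 0" if "k < m" for k
    unfolding coeff_ray_poly poly_val_def using assms(2) that by (intro sum.neutral) auto
  then have "monom 1 m dvd ray_poly I N p a v" by (simp add: monom_1_dvd_iff')
  then obtain g where "ray_poly I N p a v = monom 1 m * g" by (elim dvdE)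
  then show "\<exists>g. \<forall>s. poly_val I N p (\<lambda>i. a i + s * v i) = s ^ m * poly g s"
    by (metis poly_ray_poly[OF assms(1)] poly_mult poly_monom mult_1)
qed

text \<open>On every line the coefficient of \<open>s^k\<close> with \<open>k = sum j I\<close>
  vanishes. As a function of the direction it is a polynomial whose coefficients are the Hasse
  derivatives of order \<open>k\<close>, so these are zero over an infinite domain.\<close>

lemma hasse_if_vanishes_to_order:
  fixes p :: "(nat \<Rightarrow> nat) \<Rightarrow> 'r::idom"
  assumes "finite I" "infinite (UNIV :: 'r set)" "vanishes_to_order (poly_val I N p) a m"
    and "j \<in> box I N" "sum j I < m"
  shows "hasse I N p a j = 0"
proof -
  have "poly_val I N (\<lambda>i. if sum i I = sum j I then hasse I N p a i else 0) v = 0" for v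
  proof -
    obtain g where "\<And>s. poly_val I N p (\<lambda>i. a i + s * v i) = s ^ m * poly g s"
      using assms(3) unfolding vanishes_to_order_def by blast
    then have "ray_poly I N p a v = monom 1 m * g"
      by (intro poly_eqI_infinite[OF assms(2)])
        (simp add: poly_ray_poly[OF assms(1)] poly_monom)
    then have "coeff (ray_poly I N p a v) (sum j I) = 0"
      using assms(5) by (simp add: coeff_monom_mult)
    then show ?thesis by (simp add: coeff_ray_poly)
  qed
  from poly_val_eq_0_imp[OF assms(1,2) this assms(4)] show ?thesis by simp
qed

text \<open>The second hypothesis says that the substitution carries the line through
  \<open>b\<close> with direction \<open>v\<close> to the line through \<open>a\<close> with
  direction \<open>A' v\<close>, with the same parameter.\<close>

lemma vanishes_to_order_affine:
  assumes "vanishes_to_order f a m"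
    and "\<And>v s. (\<lambda>i. A i (\<lambda>l. b l + s * v l)) = (\<lambda>i. a i + s * A' v i)"
  shows "vanishes_to_order (\<lambda>x. f (\<lambda>i. A i x)) b m"
  using assms unfolding vanishes_to_order_def by simp

section \<open>Degree bounds for affine substitutions\<close>

definition poly_fun :: "nat set \<Rightarrow> nat \<Rightarrow> nat \<Rightarrow> ((nat \<Rightarrow> 'r::comm_ring_1) \<Rightarrow> 'r) \<Rightarrow> bool" where
  "poly_fun I N D f \<longleftrightarrow> (\<exists>p. (\<forall>\<alpha>. p \<alpha> \<noteq> 0 \<longrightarrow> sum \<alpha> I \<le> D) \<and> (\<forall>x. f x = poly_val I N p x))"

lemma poly_fun_const:
  assumes "finite I"
  shows "poly_fun I N 0 (\<lambda>_. c)"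
  unfolding poly_fun_def
proof (intro exI[of _ "\<lambda>\<alpha>. if \<alpha> = (\<lambda>_. 0) then c else 0"] conjI allI)
  fix x :: "nat \<Rightarrow> 'a"
  have "poly_val I N (\<lambda>\<alpha>. if \<alpha> = (\<lambda>_. 0) then c else 0) x
      = (\<Sum>\<alpha>\<in>box I N. if \<alpha> = (\<lambda>_. 0) then c else 0)"
    unfolding poly_val_def by (intro sum.cong) auto
  also have "\<dots> = c" using assms by (simp add: finite_funs) (simp add: funs_def)
  finally show "c = poly_val I N (\<lambda>\<alpha>. if \<alpha> = (\<lambda>_. 0) then c else 0) x" by simp
qed auto

lemma poly_fun_add:
  assumes "poly_fun I N D f" "poly_fun I N D g"
  shows "poly_fun I N D (\<lambda>x. f x + g x)"
proof -
  from assms obtain p r where pr: "\<And>\<alpha>. p \<alpha> \<noteq> 0 \<Longrightarrow> sum \<alpha> I \<le> D" "\<And>\<alpha>. r \<alpha> \<noteq> 0 \<Longrightarrow> sum \<alpha> I \<le> D"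
    "\<And>x. f x = poly_val I N p x" "\<And>x. g x = poly_val I N r x"
    unfolding poly_fun_def by blast
  have "sum \<alpha> I \<le> D" if "p \<alpha> + r \<alpha> \<noteq> 0" for \<alpha>
    using that pr(1,2)[of \<alpha>] by (cases "p \<alpha> = 0") simp_all
  moreover have "f x + g x = poly_val I N (\<lambda>\<alpha>. p \<alpha> + r \<alpha>) x" for x
    by (simp add: pr(3,4) poly_val_def sum.distrib distrib_right)
  ultimately show ?thesis
    unfolding poly_fun_def by (intro exI[of _ "\<lambda>\<alpha>. p \<alpha> + r \<alpha>"]) simp
qed

lemma poly_fun_cmult:
  assumes "poly_fun I N D f"
  shows "poly_fun I N D (\<lambda>x. c * f x)"
proof -
  from assms obtain p where "\<forall>\<alpha>. p \<alpha> \<noteq> 0 \<longrightarrow> sum \<alpha> I \<le> D" "\<forall>x. f x = poly_val I N p x"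
    unfolding poly_fun_def by blast
  then show ?thesis unfolding poly_fun_def
    by (intro exI[of _ "\<lambda>\<alpha>. c * p \<alpha>"])
      (auto simp: poly_val_def sum_distrib_left mult.assoc dest: mult_not_zero)
qed

lemma poly_fun_mono: "poly_fun I N D f \<Longrightarrow> D \<le> D' \<Longrightarrow> poly_fun I N D' f"
  unfolding poly_fun_def by (meson order_trans)

lemma poly_fun_sum:
  assumes "finite I" "\<And>k. k \<in> S \<Longrightarrow> poly_fun I N D (f k)"
  shows "poly_fun I N D (\<lambda>x. \<Sum>k\<in>S. f k x)"
  using assms(2)
  by (induction S rule: infinite_finite_induct)
    (auto intro: poly_fun_add poly_fun_mono[OF poly_fun_const[OF assms(1)]])

lemma poly_fun_coord:
  assumes "finite I" "i \<in> I" "poly_fun I N D f" "Suc D \<le> N"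
  shows "poly_fun I N (Suc D) (\<lambda>x. x i * f x)"
proof -
  from assms obtain p where p: "\<And>\<alpha>. p \<alpha> \<noteq> 0 \<Longrightarrow> sum \<alpha> I \<le> D" "\<And>x. f x = poly_val I N p x"
    unfolding poly_fun_def by blast
  have sum_upd: "sum (\<alpha>(i := k)) I + \<alpha> i = sum \<alpha> I + k" for \<alpha> :: "nat \<Rightarrow> nat" and k
  proof -
    have "sum (\<alpha>(i := k)) (I - {i}) = sum \<alpha> (I - {i})" by (rule sum.cong) auto
    then show ?thesis using assms(1,2) by (simp add: sum.remove[of I i] del: fun_upd_apply) simp
  qed
  define p' where "p' \<alpha> = (if \<alpha> i = 0 then 0 else p (\<alpha>(i := \<alpha> i - 1)))" for \<alpha>
  have val: "x i * poly_val I N p x = poly_val I N p' x" for x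
  proof -
    have "x i * poly_val I N p x = (\<Sum>\<alpha>\<in>box I N. x i * (p \<alpha> * (\<Prod>l\<in>I. x l ^ \<alpha> l)))"
      by (simp add: poly_val_def sum_distrib_left)
    also have "\<dots> = poly_val I N p' x"
      unfolding poly_val_def
    \<comment> \<open>Multiplication by \<open>x i\<close> raises the exponent of \<open>i\<close>
      by one. Exponents equal to \<open>N\<close> would leave the box, but their coefficients are 0
      because the degree is at most \<open>D < N\<close>; exponents equal to 0 do not occur in the
      product.\<close>
    proof (rule sum.reindex_bij_witness_not_neutral[where
          S' = "{\<alpha> \<in> box I N. \<alpha> i = N}" and T' = "{\<alpha> \<in> box I N. \<alpha> i = 0}"
          and j = "\<lambda>\<alpha>. \<alpha>(i := Suc (\<alpha> i))" and i = "\<lambda>\<alpha>. \<alpha>(i := \<alpha> i - 1)"])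
      fix \<alpha> assume "\<alpha> \<in> {\<alpha> \<in> box I N. \<alpha> i = N}"
      then have "p \<alpha> = 0"
        using p(1)[of \<alpha>] member_le_sum[of i I \<alpha>] assms by fastforce
      then show "x i * (p \<alpha> * (\<Prod>l\<in>I. x l ^ \<alpha> l)) = 0" by simp
    next
      fix \<alpha> assume \<alpha>: "\<alpha> \<in> box I N - {\<alpha> \<in> box I N. \<alpha> i = N}"
      then have "\<alpha> i < N" using assms(2) by (auto simp: funs_def le_less)
      with \<alpha> assms(2) show "\<alpha>(i := Suc (\<alpha> i)) \<in> box I N - {\<alpha> \<in> box I N. \<alpha> i = 0}"
        by (auto simp: funs_def)
    next
      fix \<alpha> assume "\<alpha> \<in> box I N"
      have "(\<Prod>l\<in>I. x l ^ (\<alpha>(i := Suc (\<alpha> i))) l) = x i * (\<Prod>l\<in>I. x l ^ \<alpha> l)"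
        using assms(1,2) by (simp add: prod.remove[of I i] cong: prod.cong) (simp add: mult_ac)
      then show "p' (\<alpha>(i := Suc (\<alpha> i))) * (\<Prod>l\<in>I. x l ^ (\<alpha>(i := Suc (\<alpha> i))) l)
          = x i * (p \<alpha> * (\<Prod>l\<in>I. x l ^ \<alpha> l))"
        by (simp add: p'_def mult_ac)
    next
      fix \<alpha> assume "\<alpha> \<in> box I N - {\<alpha> \<in> box I N. \<alpha> i = 0}"
      then show "\<alpha>(i := \<alpha> i - 1) \<in> box I N - {\<alpha> \<in> box I N. \<alpha> i = N}"
        using assms(2,4) by (auto simp: funs_def)
    qed (use assms in \<open>auto simp: p'_def finite_funs\<close>)
    finally show ?thesis .
  qed
  have "sum \<alpha> I \<le> Suc D" if "p' \<alpha> \<noteq> 0" for \<alpha>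
    using that p(1)[of "\<alpha>(i := \<alpha> i - 1)"] sum_upd[of \<alpha> "\<alpha> i - 1"]
    by (auto simp: p'_def split: if_splits simp del: fun_upd_apply)
  with val p(2) show ?thesis unfolding poly_fun_def by (intro exI[of _ p']) auto
qed

text \<open>A substitute for being affine: multiplication raises the degree by at most one. The
  property is closed under sums and scalar multiples, so the coefficients of a substituted
  polynomial need not be computed.\<close>

definition affine_factor where
  "affine_factor I N A \<longleftrightarrow>
    (\<forall>D f. Suc D \<le> N \<longrightarrow> poly_fun I N D f \<longrightarrow> poly_fun I N (Suc D) (\<lambda>x. A x * f x))"

lemma affine_factor_coord: "finite I \<Longrightarrow> i \<in> I \<Longrightarrow> affine_factor I N (\<lambda>x. x i)"
  by (simp add: affine_factor_def poly_fun_coord)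

lemma affine_factor_const: "affine_factor I N (\<lambda>_. c)"
  by (auto simp: affine_factor_def intro: poly_fun_mono[OF poly_fun_cmult])

lemma affine_factor_add:
  "affine_factor I N A \<Longrightarrow> affine_factor I N B \<Longrightarrow> affine_factor I N (\<lambda>x. A x + B x)"
  by (auto simp: affine_factor_def distrib_right intro!: poly_fun_add)

lemma affine_factor_cmult: "affine_factor I N A \<Longrightarrow> affine_factor I N (\<lambda>x. c * A x)"
  by (auto simp: affine_factor_def mult.assoc intro!: poly_fun_cmult)

lemma poly_fun_affine_power:
  assumes "affine_factor I N A" "poly_fun I N D f" "D + k \<le> N"
  shows "poly_fun I N (D + k) (\<lambda>x. A x ^ k * f x)"
  using assms(3)
proof (induction k)
  case (Suc k)
  then have "poly_fun I N (Suc (D + k)) (\<lambda>x. A x * (A x ^ k * f x))"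
    using assms(1) unfolding affine_factor_def by auto
  then show ?case by (simp add: mult.assoc)
qed (use assms in simp)

lemma poly_fun_affine_prod:
  assumes "finite I" "finite I'" "\<And>i. i \<in> I' \<Longrightarrow> affine_factor I N (A i)" "sum \<alpha> I' \<le> N"
  shows "poly_fun I N (sum \<alpha> I') (\<lambda>x. \<Prod>i\<in>I'. A i x ^ \<alpha> i)"
  using assms(2-)
proof (induction I' rule: finite_induct)
  case empty
  then show ?case using poly_fun_const[OF assms(1), of N 1] by simp
next
  case (insert i I')
  then have "poly_fun I N (sum \<alpha> I' + \<alpha> i) (\<lambda>x. A i x ^ \<alpha> i * (\<Prod>i\<in>I'. A i x ^ \<alpha> i))"
    by (intro poly_fun_affine_power) auto
  with insert.hyps show ?case by (simp add: add.commute)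
qed

lemma poly_fun_affine_subst:
  assumes "finite I" "\<And>i. i \<in> I \<Longrightarrow> affine_factor I N (A i)" "D \<le> N"
    and "\<And>\<alpha>. \<alpha> \<in> box I N \<Longrightarrow> p \<alpha> \<noteq> 0 \<Longrightarrow> sum \<alpha> I \<le> D"
  shows "poly_fun I N D (\<lambda>x. poly_val I N p (\<lambda>i. A i x))"
  unfolding poly_val_def
proof (rule poly_fun_sum[OF assms(1)])
  fix \<alpha> assume "\<alpha> \<in> box I N"
  show "poly_fun I N D (\<lambda>x. p \<alpha> * (\<Prod>i\<in>I. A i x ^ \<alpha> i))"
  proof (cases "p \<alpha> = 0")
    case True
    then show ?thesis using poly_fun_mono[OF poly_fun_const[OF assms(1), of N 0]] by simp
  next
    case False
    then have "sum \<alpha> I \<le> D" using assms(4) \<open>\<alpha> \<in> box I N\<close> by blast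
    then show ?thesis
      using assms by (intro poly_fun_cmult poly_fun_mono[OF poly_fun_affine_prod]) auto
  qed
qed

section \<open>Polynomials in two groups of variables\<close>

lemma poly_val_union:
  fixes h :: "(nat \<Rightarrow> nat) \<Rightarrow> 'r::comm_ring_1"
  assumes "finite I" "finite J" "I \<inter> J = {}"
  shows "poly_val (I \<union> J) N h x = poly_val I N
    (\<lambda>\<alpha>. \<Sum>\<beta>\<in>box J N. h (\<lambda>i. \<alpha> i + \<beta> i) * (\<Prod>i\<in>J. x i ^ \<beta> i)) x"
proof -
  have "(\<Prod>i\<in>I \<union> J. x i ^ (\<alpha> i + \<beta> i)) = (\<Prod>i\<in>I. x i ^ \<alpha> i) * (\<Prod>i\<in>J. x i ^ \<beta> i)"
    if "\<alpha> \<in> box I N" "\<beta> \<in> box J N" for \<alpha> \<beta>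
  proof -
    have "(\<Prod>i\<in>I. x i ^ (\<alpha> i + \<beta> i)) = (\<Prod>i\<in>I. x i ^ \<alpha> i)"
      using that assms(3) by (intro prod.cong) (auto simp: funs_def)
    moreover have "(\<Prod>i\<in>J. x i ^ (\<alpha> i + \<beta> i)) = (\<Prod>i\<in>J. x i ^ \<beta> i)"
      using that assms(3) by (intro prod.cong) (auto simp: funs_def)
    ultimately show ?thesis using assms by (simp add: prod.union_disjoint)
  qed
  then show ?thesis unfolding poly_val_def using assms(3)
    by (simp add: sum_funs_union sum_distrib_left sum_distrib_right mult_ac cong: sum.cong)
qed

text \<open>Where the variables in \<open>I\<close> are 0, differentiation in them picks out a
  coefficient: only terms with exponent exactly \<open>j\<close> on \<open>I\<close> survive. What
  remains is a derivative in the variables of \<open>J\<close>.\<close>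

lemma hasse_zero_base:
  fixes h :: "(nat \<Rightarrow> nat) \<Rightarrow> 'r::comm_ring_1"
  assumes "finite I" "finite J" "I \<inter> J = {}" "j \<in> box I N" "b \<in> box J N"
    and "\<And>i. i \<in> I \<Longrightarrow> x i = 0"
  shows "hasse (I \<union> J) N h x (\<lambda>i. j i + b i) = hasse J N (\<lambda>\<beta>. h (\<lambda>i. j i + \<beta> i)) x b"
proof -
  have eq: "(\<Prod>i\<in>I \<union> J. of_nat (\<alpha> i + \<beta> i choose (j i + b i)) * x i ^ (\<alpha> i + \<beta> i - (j i + b i)))
      = (if \<alpha> = j then \<Prod>i\<in>J. of_nat (\<beta> i choose b i) * x i ^ (\<beta> i - b i) else 0)"
    if "\<alpha> \<in> box I N" "\<beta> \<in> box J N" for \<alpha> \<beta>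
  proof -
    have "(\<Prod>i\<in>I. of_nat (\<alpha> i + \<beta> i choose (j i + b i)) * x i ^ (\<alpha> i + \<beta> i - (j i + b i)))
        = (\<Prod>i\<in>I. if \<alpha> i = j i then 1 else 0)"
      using that assms(3-6) by (intro prod.cong) (auto simp: funs_def disjoint_iff binomial_eq_0 linorder_neq_iff zero_power)
    also have "\<dots> = (if \<alpha> = j then 1 else 0)"
    proof (cases "\<alpha> = j")
      case False
      then have "\<exists>i\<in>I. \<alpha> i \<noteq> j i" using that(1) assms(4) by (fastforce simp: funs_def fun_eq_iff)
      then show ?thesis using assms(1) False by (auto intro!: prod_zero)
    qed simp
    finally have 1: "(\<Prod>i\<in>I. of_nat (\<alpha> i + \<beta> i choose (j i + b i)) * x i ^ (\<alpha> i + \<beta> i - (j i + b i)))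
        = (if \<alpha> = j then 1 else 0)" .
    have 2: "(\<Prod>i\<in>J. of_nat (\<alpha> i + \<beta> i choose (j i + b i)) * x i ^ (\<alpha> i + \<beta> i - (j i + b i)))
        = (\<Prod>i\<in>J. of_nat (\<beta> i choose b i) * x i ^ (\<beta> i - b i))"
    proof (rule prod.cong[OF refl])
      fix i assume "i \<in> J"
      then have "\<alpha> i = 0" "j i = 0" using that assms(3,4) by (auto simp: funs_def)
      then show "of_nat (\<alpha> i + \<beta> i choose (j i + b i)) * x i ^ (\<alpha> i + \<beta> i - (j i + b i))
          = of_nat (\<beta> i choose b i) * x i ^ (\<beta> i - b i)" by simp
    qed
    show ?thesis using assms(1-3) by (simp add: prod.union_disjoint 1 2)
  qed
  have "hasse (I \<union> J) N h x (\<lambda>i. j i + b i) = (\<Sum>\<alpha>\<in>box I N. \<Sum>\<beta>\<in>box J N. h (\<lambda>i. \<alpha> i + \<beta> i) *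
      (if \<alpha> = j then \<Prod>i\<in>J. of_nat (\<beta> i choose b i) * x i ^ (\<beta> i - b i) else 0))"
    unfolding hasse_def using assms(3) eq by (simp add: sum_funs_union cong: sum.cong)
  also have "\<dots> = (\<Sum>\<alpha>\<in>box I N. if \<alpha> = j then hasse J N (\<lambda>\<beta>. h (\<lambda>i. j i + \<beta> i)) x b else 0)"
    unfolding hasse_def by (intro sum.cong) auto
  also have "\<dots> = hasse J N (\<lambda>\<beta>. h (\<lambda>i. j i + \<beta> i)) x b"
    using assms(1,4) by (simp add: finite_funs)
  finally show ?thesis .
qed

lemma hasse_diff: "hasse I N (\<lambda>\<alpha>. p \<alpha> - r \<alpha>) a j = hasse I N p a j - hasse I N r a j"
  by (simp add: hasse_def left_diff_distrib sum_subtractf)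

text \<open>Pigeonhole in place of linear algebra: over a finite field there are more coefficient
  vectors on \<open>E\<close> than tables of derivative values, so two of them have the same table.
  Their difference is the polynomial.\<close>

lemma exists_vanishing_polynomial:
  fixes K :: "(nat \<Rightarrow> 'a::{finite,field}) set"
  assumes "finite K" "finite E" "finite J" "card K * card J < card E" "E \<subseteq> box I N"
  obtains p :: "(nat \<Rightarrow> nat) \<Rightarrow> 'a" where "\<exists>\<alpha>\<in>E. p \<alpha> \<noteq> 0" "\<And>\<alpha>. \<alpha> \<notin> E \<Longrightarrow> p \<alpha> = 0"
    "\<And>a j. a \<in> K \<Longrightarrow> j \<in> J \<Longrightarrow> hasse I N p a j = 0"
proof -
  define ext where "ext p \<alpha> = (if \<alpha> \<in> E then p \<alpha> else (0::'a))" for p \<alpha>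
  define \<Phi> where "\<Phi> p = restrict (\<lambda>(a, j). hasse I N (ext p) a j) (K \<times> J)" for p
  have card: "card (X \<rightarrow>\<^sub>E (UNIV :: 'a set)) = card (UNIV :: 'a set) ^ card X" if "finite X" for X :: "'x set"
    using that by (simp add: card_PiE)
  have "\<not> inj_on \<Phi> (E \<rightarrow>\<^sub>E UNIV)"
  proof
    assume "inj_on \<Phi> (E \<rightarrow>\<^sub>E UNIV)"
    moreover have "\<Phi> ` (E \<rightarrow>\<^sub>E UNIV) \<subseteq> (K \<times> J) \<rightarrow>\<^sub>E UNIV" by (simp add: image_subset_iff \<Phi>_def restrict_PiE_iff)
    ultimately have "card (E \<rightarrow>\<^sub>E (UNIV::'a set)) \<le> card ((K \<times> J) \<rightarrow>\<^sub>E (UNIV::'a set))"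
      using assms by (intro card_inj_on_le) (auto intro: finite_PiE)
    then have "card (UNIV :: 'a set) ^ card E \<le> card (UNIV :: 'a set) ^ (card K * card J)"
      using assms by (simp add: card card_cartesian_product)
    moreover have "1 < card (UNIV :: 'a set)"
      using card_mono[of "UNIV :: 'a set" "{0, 1}"] by simp
    ultimately have "card E \<le> card K * card J" using power_le_imp_le_exp by blast
    then show False using assms(4) by simp
  qed
  then obtain p1 p2 where p: "p1 \<in> E \<rightarrow>\<^sub>E UNIV" "p2 \<in> E \<rightarrow>\<^sub>E UNIV" "\<Phi> p1 = \<Phi> p2" "p1 \<noteq> p2"
    by (auto simp: inj_on_def)
  then obtain \<alpha> where "\<alpha> \<in> E" "p1 \<alpha> \<noteq> p2 \<alpha>" by (metis PiE_ext)
  show ?thesis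
  proof (rule that[of "\<lambda>\<alpha>. ext p1 \<alpha> - ext p2 \<alpha>"])
    show "\<exists>\<alpha>\<in>E. ext p1 \<alpha> - ext p2 \<alpha> \<noteq> 0"
      using \<open>\<alpha> \<in> E\<close> \<open>p1 \<alpha> \<noteq> p2 \<alpha>\<close> by (auto simp: ext_def)
    fix a j assume "a \<in> K" "j \<in> J"
    then show "hasse I N (\<lambda>\<alpha>. ext p1 \<alpha> - ext p2 \<alpha>) a j = 0"
      using fun_cong[OF p(3), of "(a, j)"] by (simp add: \<Phi>_def hasse_diff)
  qed (simp add: ext_def)
qed

text \<open>Carries vanishing conditions from \<open>F\<close> to \<open>F[X]\<close>, where
  coefficients can be recovered from values.\<close>

lemma hasse_const_poly:
  "hasse I N (\<lambda>\<alpha>. [:p \<alpha>:]) (\<lambda>i. [:a i:]) j = [:hasse I N p a j:]"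
  unfolding hasse_def sum_to_poly[symmetric]
proof (rule sum.cong[OF refl])
  fix \<alpha>
  have "of_nat (\<alpha> i choose j i) * [:a i:] ^ (\<alpha> i - j i)
      = [:of_nat (\<alpha> i choose j i) * a i ^ (\<alpha> i - j i):]" for i
    by (simp add: poly_const_pow of_nat_poly mult.commute)
  then show "[:p \<alpha>:] * (\<Prod>i\<in>I. of_nat (\<alpha> i choose j i) * [:a i:] ^ (\<alpha> i - j i))
      = [:p \<alpha> * (\<Prod>i\<in>I. of_nat (\<alpha> i choose j i) * a i ^ (\<alpha> i - j i)):]"
    by (simp only: prod_to_poly) simp
qed

lemma infinite_UNIV_poly: "infinite (UNIV :: 'a::comm_semiring_1 poly set)"
proof
  assume "finite (UNIV :: 'a poly set)"
  moreover have "inj (\<lambda>k. monom (1::'a) k)"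
    by (rule injI) (metis degree_monom_eq one_neq_zero)
  ultimately show False
    using finite_imageD[of "\<lambda>k. monom (1::'a) k" UNIV] infinite_UNIV_nat
    by (meson finite_subset subset_UNIV)
qed

section \<open>Kakeya sets of planes\<close>

lemma vecs_eq_funs: "vecs n = funs {..<n} UNIV"
  by (auto simp: vecs_def funs_def not_less)

text \<open>The last two coordinates of \<open>F^(t + 2)\<close> parametrise the planes in question, so that \<open>B\<close>
  encodes the direction spanned by \<open>(b\<^sub>0, 1, 0)\<close> and \<open>(b\<^sub>1, 0, 1)\<close> with \<open>b\<^sub>l\<close> the columns of \<open>B\<close>.\<close>

definition plane_point :: "nat \<Rightarrow> (nat \<Rightarrow> 'a::comm_ring_1) \<Rightarrow> (nat \<Rightarrow> nat \<Rightarrow> 'a) \<Rightarrow> (nat \<Rightarrow> 'a) \<Rightarrow> nat \<Rightarrow> 'a" where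
  "plane_point t y B c =
    (\<lambda>i. if i < t then y i + (B i 0 * c 0 + B i 1 * c 1) else if i < t + 2 then c (i - t) else 0)"

definition direction :: "nat \<Rightarrow> (nat \<Rightarrow> nat \<Rightarrow> 'a::comm_ring_1) \<Rightarrow> nat \<Rightarrow> 'a poly" where
  "direction t B = (\<lambda>i. if i < t then [:B i 0, B i 1:] else 0)"

text \<open>The homogeneous part of degree \<open>D\<close> with the last two variables set to 1 and
  \<open>X\<close>. Nothing is lost: the power of \<open>X\<close> and homogeneity determine the
  exponents of both variables.\<close>

definition top_form ::
    "nat \<Rightarrow> nat \<Rightarrow> nat \<Rightarrow> ((nat \<Rightarrow> nat) \<Rightarrow> 'a::comm_ring_1 poly) \<Rightarrow> (nat \<Rightarrow> nat) \<Rightarrow> 'a poly" where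
  "top_form t N D p \<alpha> = (\<Sum>\<beta>\<in>box {t, t + 1} N.
      (if sum \<alpha> {..<t} + sum \<beta> {t, t + 1} = D then p (\<lambda>i. \<alpha> i + \<beta> i) else 0) * [:0, 1:] ^ \<beta> (t + 1))"

lemma coeff_ray_poly_top:
  assumes "finite I" "\<And>\<alpha>. \<alpha> \<in> box I N \<Longrightarrow> p \<alpha> \<noteq> 0 \<Longrightarrow> sum \<alpha> I \<le> D"
  shows "coeff (ray_poly I N p a v) D = poly_val I N (\<lambda>\<alpha>. if sum \<alpha> I = D then p \<alpha> else 0) v"
  unfolding coeff_ray_poly poly_val_def
  by (intro sum.cong refl) (use assms in \<open>auto simp: hasse_top\<close>)

lemma index_split: "{..<t + 2} = {..<t} \<union> {t, t + 1}" for t :: nat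
  by auto

lemma sum_index_split:
  assumes "\<alpha> \<in> box {..<t} N" "\<beta> \<in> box {t, t + 1} N"
  shows "sum (\<lambda>i. \<alpha> i + \<beta> i) {..<t + 2} = sum \<alpha> {..<t} + sum \<beta> {t, t + 1}"
proof -
  have "sum \<beta> {..<t} = 0" "sum \<alpha> {t, t + 1} = 0"
    using assms by (auto simp: funs_def)
  moreover have "sum (\<lambda>i. \<alpha> i + \<beta> i) {..<t + 2}
      = sum (\<lambda>i. \<alpha> i + \<beta> i) {..<t} + sum (\<lambda>i. \<alpha> i + \<beta> i) {t, t + 1}"
    unfolding index_split by (rule sum.union_disjoint) auto
  ultimately show ?thesis by (simp add: sum.distrib)
qed

lemma poly_val_top_form:
  assumes "x t = 1" "x (t + 1) = [:0, 1:]"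
  shows "poly_val {..<t + 2} N (\<lambda>\<alpha>. if sum \<alpha> {..<t + 2} = D then p \<alpha> else 0) x
    = poly_val {..<t} N (top_form t N D p) x"
proof -
  have "(\<Prod>i\<in>{t, t + 1}. x i ^ \<beta> i) = [:0, 1:] ^ \<beta> (t + 1)" for \<beta> :: "nat \<Rightarrow> nat"
    using assms by simp
  then have "(\<Sum>\<beta>\<in>box {t, t + 1} N. (if sum (\<lambda>i. \<alpha> i + \<beta> i) {..<t + 2} = D then p (\<lambda>i. \<alpha> i + \<beta> i) else 0)
      * (\<Prod>i\<in>{t, t + 1}. x i ^ \<beta> i)) = top_form t N D p \<alpha>" if "\<alpha> \<in> box {..<t} N" for \<alpha>
    unfolding top_form_def by (intro sum.cong refl) (simp only: sum_index_split[OF that])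
  moreover have "poly_val {..<t + 2} N h x = poly_val {..<t} N
      (\<lambda>\<alpha>. \<Sum>\<beta>\<in>box {t, t + 1} N. h (\<lambda>i. \<alpha> i + \<beta> i) * (\<Prod>i\<in>{t, t + 1}. x i ^ \<beta> i)) x" for h
    unfolding index_split by (rule poly_val_union) auto
  ultimately show ?thesis
    unfolding poly_val_def[of "{..<t}"] by (simp only: cong: sum.cong)
qed

text \<open>Substituting the affine parametrisation of a plane through \<open>K\<close> turns its two parameters
  into separate variables: the coefficients with respect to these two variables vanish by
  Schwartz-Zippel on the plane, and their top degree part is the Taylor expansion of the top form
  at the direction of the plane.\<close>

lemma hasse_top_form_direction:
  fixes K :: "(nat \<Rightarrow> 'a::{finite,field}) set" and p :: "(nat \<Rightarrow> nat) \<Rightarrow> 'a"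
  assumes van: "\<And>a j. a \<in> K \<Longrightarrow> j \<in> box {..<t + 2} N \<Longrightarrow> sum j {..<t + 2} < m \<Longrightarrow> hasse {..<t + 2} N p a j = 0"
    and deg: "\<And>\<alpha>. \<alpha> \<in> box {..<t + 2} N \<Longrightarrow> p \<alpha> \<noteq> 0 \<Longrightarrow> sum \<alpha> {..<t + 2} \<le> D" and "D \<le> N"
    and y: "\<kappa> \<le> card {c \<in> vecs 2. plane_point t y B c \<in> K}"
    and par: "\<And>w. w < m' \<Longrightarrow> (D - w) * card (UNIV :: 'a set) < (m - w) * \<kappa>"
    and j: "j \<in> box {..<t} N" "sum j {..<t} < m'"
  shows "hasse {..<t} N (top_form t N D (\<lambda>\<alpha>. [:p \<alpha>:])) (direction t B) j = 0"
proof -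
  let ?I = "{..<t + 2}" and ?V = "{..<t}" and ?J = "{t, t + 1}"
  let ?p = "\<lambda>\<alpha>. [:p \<alpha>:]"
  have inf: "infinite (UNIV :: 'a poly set)" by (rule infinite_UNIV_poly)
  have disj: "?V \<inter> ?J = {}" by auto
  \<comment> \<open>\<open>A\<close> adapts the coordinates to the plane: the last two variables
    become the plane parameters, the others a displacement from the plane. \<open>A'\<close> is its
    linear part, and \<open>r\<close> below is the polynomial in the adapted coordinates.\<close>
  define A where "A i x = (if i < t then x i + ([:y i:] + ([:B i 0:] * x t + [:B i 1:] * x (t + 1))) else x i)"
    for i and x :: "nat \<Rightarrow> 'a poly"
  define A' where "A' v i = (if i < t then v i + ([:B i 0:] * v t + [:B i 1:] * v (t + 1)) else v i)"
    for i and v :: "nat \<Rightarrow> 'a poly"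
  have A_line: "(\<lambda>i. A i (\<lambda>l. b l + s * v l)) = (\<lambda>i. A i b + s * A' v i)" for b v s
    by (auto simp: A_def A'_def algebra_simps fun_eq_iff)
  have "poly_fun ?I N D (\<lambda>x. poly_val ?I N ?p (\<lambda>i. A i x))"
  proof (rule poly_fun_affine_subst[OF _ _ \<open>D \<le> N\<close>])
    show "affine_factor ?I N (A i)" if "i \<in> ?I" for i
    proof (cases "i < t")
      case True
      then have "A i = (\<lambda>x. x i + ([:y i:] + ([:B i 0:] * x t + [:B i 1:] * x (t + 1))))"
        by (simp add: A_def fun_eq_iff)
      then show ?thesis
        using that by (simp only:) (intro affine_factor_add affine_factor_cmult affine_factor_const
            affine_factor_coord, simp_all)
    next
      case False
      then have "A i = (\<lambda>x. x i)" by (simp add: A_def fun_eq_iff)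
      then show ?thesis using that by (simp only:) (intro affine_factor_coord, simp_all)
    qed
  qed (use deg in auto)
  then obtain r where r: "\<And>\<alpha>. r \<alpha> \<noteq> 0 \<Longrightarrow> sum \<alpha> ?I \<le> D"
    "\<And>x. poly_val ?I N ?p (\<lambda>i. A i x) = poly_val ?I N r x"
    unfolding poly_fun_def by blast
  define base where "base c i = (if i < t then 0 else if i < t + 2 then [:c (i - t):] else 0)"
    for c :: "nat \<Rightarrow> 'a" and i :: nat
  have base_val: "(\<lambda>i. A i (base c)) = (\<lambda>i. [:plane_point t y B c i:])" for c
    by (auto simp: A_def base_def plane_point_def fun_eq_iff mult.commute)
  have van_r: "hasse ?I N r (base c) j = 0"
    if c: "plane_point t y B c \<in> K" and j: "j \<in> box ?I N" "sum j ?I < m" for c j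
  proof (rule hasse_if_vanishes_to_order[OF _ inf _ j])
    have "vanishes_to_order (poly_val ?I N ?p) (\<lambda>i. [:plane_point t y B c i:]) m"
      by (rule vanishes_to_order_if_hasse) (use van[OF c] in \<open>auto simp: hasse_const_poly\<close>)
    then have "vanishes_to_order (\<lambda>x. poly_val ?I N ?p (\<lambda>i. A i x)) (base c) m"
    proof (rule vanishes_to_order_affine)
      fix v s
      show "(\<lambda>i. A i (\<lambda>l. base c l + s * v l)) = (\<lambda>i. [:plane_point t y B c i:] + s * A' v i)"
        unfolding A_line using fun_cong[OF base_val[of c]] by (intro ext) simp
    qed
    moreover have "(\<lambda>x. poly_val ?I N ?p (\<lambda>i. A i x)) = poly_val ?I N r"
      using r(2) by (rule ext)
    ultimately show "vanishes_to_order (poly_val ?I N r) (base c) m" by (simp only:)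
  qed simp
  \<comment> \<open>Fixing the exponents \<open>j\<close> of the first \<open>t\<close> variables
    leaves a polynomial of degree at most \<open>D - w\<close> in the two plane parameters. It
    vanishes to order \<open>m - w\<close> at the at least \<open>\<kappa>\<close> parameters whose
    plane points lie in \<open>K\<close>, and \<open>par\<close> contradicts the Schwartz-Zippel
    bound on the grid of side \<open>q\<close>.\<close>
  have r_low: "r (\<lambda>i. j i + \<beta> i) = 0"
    if j: "j \<in> box ?V N" "sum j ?V < m'" and \<beta>: "\<beta> \<in> box ?J N" for j \<beta>
  proof (rule ccontr)
    assume nz: "r (\<lambda>i. j i + \<beta> i) \<noteq> 0"
    define w where "w = sum j ?V"
    define C where "C = {c \<in> vecs 2. plane_point t y B c \<in> K}"
    define T :: "'a poly set" where "T = range (\<lambda>u. [:u:])"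
    have card_T: "card T = card (UNIV :: 'a set)"
      unfolding T_def by (rule card_image) (auto intro: injI)
    have fin_T: "finite T" unfolding T_def by simp
    have inj: "inj_on base C"
    proof (rule inj_onI)
      fix c c' assume "c \<in> C" "c' \<in> C" and eq: "base c = base c'"
      have "c i = c' i" if "i < 2" for i
        using fun_cong[OF eq, of "i + t"] that by (simp add: base_def)
      moreover have "c i = c' i" if "\<not> i < 2" for i
        using \<open>c \<in> C\<close> \<open>c' \<in> C\<close> that by (auto simp: C_def vecs_def)
      ultimately show "c = c'" by blast
    qed
    have base_funs: "base ` C \<subseteq> funs ?J T"
      by (auto simp: base_def T_def funs_def)
    have fin_C: "finite C" using finite_funs[of "{..<2}" "UNIV :: 'a set"]
      by (simp add: C_def vecs_eq_funs)
    have "card T * (\<Sum>x\<in>funs ?J T. if x \<in> base ` C then m - w else 0) \<le> (D - w) * card T ^ card ?J"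
    proof (rule schwartz_zippel_multiplicity[of ?J T N "\<lambda>\<beta>. r (\<lambda>i. j i + \<beta> i)"])
      show "sum \<alpha> ?J \<le> D - w" if "\<alpha> \<in> box ?J N" "r (\<lambda>i. j i + \<alpha> i) \<noteq> 0" for \<alpha>
        using r(1)[OF that(2)] sum_index_split[OF j(1) that(1)] by (simp add: w_def)
      fix x b assume x: "x \<in> funs ?J T" and b: "b \<in> box ?J N"
        and less: "sum b ?J < (if x \<in> base ` C then m - w else 0)"
      then obtain c where c: "c \<in> C" "x = base c" by (auto split: if_splits)
      have "hasse (?V \<union> ?J) N r (base c) (\<lambda>i. j i + b i) = 0"
        unfolding index_split[symmetric]
      proof (rule van_r)
        show "plane_point t y B c \<in> K" using c by (simp add: C_def)
        show "(\<lambda>i. j i + b i) \<in> box ?I N"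
          unfolding index_split using j(1) b by (fastforce simp: funs_def)
        show "(\<Sum>i<t + 2. j i + b i) < m"
          using less sum_index_split[OF j(1) b] by (auto simp: w_def split: if_splits)
      qed
      then show "hasse ?J N (\<lambda>\<beta>. r (\<lambda>i. j i + \<beta> i)) x b = 0"
        using hasse_zero_base[OF _ _ disj j(1) b, of "base c" r] c(2) by (simp add: base_def)
    qed (use nz \<beta> fin_T in auto)
    moreover have "(\<Sum>x\<in>funs ?J T. if x \<in> base ` C then m - w else 0) = card C * (m - w)"
      using base_funs fin_T card_image[OF inj]
      by (simp add: sum.If_cases finite_funs Int_absorb1 flip: Collect_conj_eq)
    ultimately have "card T * (card C * (m - w)) \<le> card T * ((D - w) * card T)"
      by (simp add: power2_eq_square mult_ac)
    moreover have "0 < card T" by (simp add: card_T card_gt_0_iff)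
    ultimately have "card C * (m - w) \<le> (D - w) * card T" by simp
    moreover have "\<kappa> * (m - w) \<le> card C * (m - w)"
      using y unfolding C_def by (rule mult_right_mono) simp
    moreover have "(D - w) * card T < \<kappa> * (m - w)"
      using par[of w] j(2) unfolding w_def card_T by (simp only: mult.commute)
    ultimately show False by linarith
  qed
  have top_r: "top_form t N D r j = 0" if "j \<in> box ?V N" "sum j ?V < m'" for j
    unfolding top_form_def using r_low[OF that] by (intro sum.neutral) auto
  \<comment> \<open>Compare the coefficients of degree \<open>D\<close> along a line with direction
    \<open>v\<close> in adapted coordinates. As the last two entries of \<open>v\<close> are
    \<open>1\<close> and \<open>X\<close>, the vector \<open>A' v\<close> is the plane direction
    displaced by \<open>z\<close>, and both coefficients become values of top forms.\<close>
  have key: "poly_val ?V N (top_form t N D ?p) (\<lambda>i. direction t B i + z i)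
      = poly_val ?V N (top_form t N D r) z" for z
  proof -
    define v where "v i = (if i < t then z i else if i = t then 1 else if i = t + 1 then [:0, 1:] else 0)" for i
    have eq: "ray_poly ?I N ?p (\<lambda>i. A i (\<lambda>_. 0)) (A' v) = ray_poly ?I N r (\<lambda>_. 0) v"
    proof (rule poly_eqI_infinite[OF inf])
      fix s
      have "poly_val ?I N ?p (\<lambda>i. A i (\<lambda>_. 0) + s * A' v i) = poly_val ?I N r (\<lambda>i. 0 + s * v i)"
        using r(2)[of "\<lambda>i. 0 + s * v i"] by (simp only: A_line)
      then show "poly (ray_poly ?I N ?p (\<lambda>i. A i (\<lambda>_. 0)) (A' v)) s
          = poly (ray_poly ?I N r (\<lambda>_. 0) v) s"
        by (simp add: poly_ray_poly)
    qed
have "poly_val ?I N (\<lambda>\<alpha>. if sum \<alpha> ?I = D then ?p \<alpha> else 0) (A' v)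
        = coeff (ray_poly ?I N ?p (\<lambda>i. A i (\<lambda>_. 0)) (A' v)) D"
      by (rule coeff_ray_poly_top[symmetric]) (use deg in auto)
    moreover have "coeff (ray_poly ?I N r (\<lambda>_. 0) v) D
        = poly_val ?I N (\<lambda>\<alpha>. if sum \<alpha> ?I = D then r \<alpha> else 0) v"
      by (rule coeff_ray_poly_top) (use r(1) in auto)
    ultimately have "poly_val ?I N (\<lambda>\<alpha>. if sum \<alpha> ?I = D then ?p \<alpha> else 0) (A' v)
        = poly_val ?I N (\<lambda>\<alpha>. if sum \<alpha> ?I = D then r \<alpha> else 0) v"
      unfolding eq by (rule trans)
    moreover have "A' v t = 1" "A' v (t + 1) = [:0, 1:]" "v t = 1" "v (t + 1) = [:0, 1:]"
      by (simp_all add: A'_def v_def)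
    ultimately have "poly_val ?V N (top_form t N D ?p) (A' v) = poly_val ?V N (top_form t N D r) v"
      by (simp only: poly_val_top_form)
    moreover have "poly_val ?V N h (A' v) = poly_val ?V N h (\<lambda>i. direction t B i + z i)" for h
      unfolding poly_val_def
      by (intro sum.cong refl arg_cong2[where f = "(*)"] prod.cong)
        (auto simp: A'_def v_def direction_def algebra_simps)
    moreover have "poly_val ?V N h v = poly_val ?V N h z" for h
      unfolding poly_val_def
      by (intro sum.cong refl arg_cong2[where f = "(*)"] prod.cong) (auto simp: v_def)
    ultimately show ?thesis by simp
  qed
  \<comment> \<open>The right side of \<open>key\<close> is thus the Taylor expansion of the left
    one; equality for all \<open>z\<close> over the infinite ring \<open>F[X]\<close> identifies the
    coefficients.\<close>
  have "poly_val ?V N (\<lambda>j. hasse ?V N (top_form t N D ?p) (direction t B) j - top_form t N D r j) z = 0" for z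
    using key[of z] unfolding taylor[OF finite_lessThan]
    by (simp add: poly_val_def left_diff_distrib sum_subtractf)
  from poly_val_eq_0_imp[OF _ inf this j(1)] show ?thesis using top_r[OF j] by simp
qed

lemma inj_on_direction: "inj_on (direction t) (mats t 2)"
proof (rule inj_onI)
  fix B B' :: "nat \<Rightarrow> nat \<Rightarrow> 'a" assume B: "B \<in> mats t 2" "B' \<in> mats t 2" "direction t B = direction t B'"
  show "B = B'"
  proof (intro ext)
    fix i l
    show "B i l = B' i l"
    proof (cases "i < t \<and> l < 2")
      case True
      then have "[:B i 0, B i 1:] = [:B' i 0, B' i 1:]"
        using fun_cong[OF B(3), of i] by (simp add: direction_def)
      then show ?thesis using True by (auto simp: less_2_cases_iff)
    next
      case False
      then show ?thesis using B(1,2) by (auto simp: mats_def not_less)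
    qed
  qed
qed

text \<open>Distinct exponents \<open>\<beta>\<close> contributing to the same entry carry different
  powers of \<open>X\<close>, so nothing cancels and a coefficient of \<open>p\<close> can be read
  off.\<close>

lemma top_form_nonzero:
  fixes p :: "(nat \<Rightarrow> nat) \<Rightarrow> 'a::field"
  assumes "\<alpha> \<in> box {..<t + 2} N" "p \<alpha> \<noteq> 0" "sum \<alpha> {..<t + 2} = D"
  shows "\<exists>\<alpha>'\<in>box {..<t} N. top_form t N D (\<lambda>\<alpha>. [:p \<alpha>:]) \<alpha>' \<noteq> 0"
proof -
  define \<alpha>' where "\<alpha>' i = (if i < t then \<alpha> i else 0)" for i
  define \<beta>' where "\<beta>' i = (if i \<in> {t, t + 1} then \<alpha> i else 0)" for i
  have \<alpha>': "\<alpha>' \<in> box {..<t} N" and \<beta>': "\<beta>' \<in> box {t, t + 1} N"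
    using assms(1) by (auto simp: funs_def \<alpha>'_def \<beta>'_def)
  have \<alpha>: "\<alpha> = (\<lambda>i. \<alpha>' i + \<beta>' i)"
    using assms(1) by (auto simp: funs_def \<alpha>'_def \<beta>'_def fun_eq_iff)
  have sums: "sum \<alpha>' {..<t} + sum \<beta>' {t, t + 1} = D"
    using sum_index_split[OF \<alpha>' \<beta>'] assms(3) unfolding \<alpha>[symmetric] by (rule trans[OF sym])
  have "coeff ((if sum \<alpha>' {..<t} + sum \<beta> {t, t + 1} = D then [:p (\<lambda>i. \<alpha>' i + \<beta> i):] else 0)
        * [:0, 1:] ^ \<beta> (t + 1)) (\<beta>' (t + 1)) = (if \<beta> = \<beta>' then p \<alpha> else 0)"
    if "\<beta> \<in> box {t, t + 1} N" for \<beta>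
  proof -
    have "\<beta> = \<beta>'" if "\<beta> (t + 1) = \<beta>' (t + 1)" "sum \<alpha>' {..<t} + sum \<beta> {t, t + 1} = D"
    proof
      fix i
      show "\<beta> i = \<beta>' i"
        using that sums \<open>\<beta> \<in> box {t, t + 1} N\<close> \<beta>' by (cases "i \<in> {t, t + 1}") (auto simp: funs_def)
    qed
    moreover have "[:0, 1:] ^ k = monom (1::'a) k" for k by (simp add: monom_altdef)
    ultimately show ?thesis using sums \<alpha> by auto
  qed
  then have "coeff (top_form t N D (\<lambda>\<alpha>. [:p \<alpha>:]) \<alpha>') (\<beta>' (t + 1))
      = (\<Sum>\<beta>\<in>box {t, t + 1} N. if \<beta> = \<beta>' then p \<alpha> else 0)"
    unfolding top_form_def coeff_sum by (intro sum.cong) auto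
  also have "\<dots> = p \<alpha>" using \<beta>' by (simp add: finite_funs)
  finally show ?thesis using assms(2) \<alpha>' by (intro bexI[of _ \<alpha>']) auto
qed

text \<open>If \<open>K\<close> were too small, a nonzero polynomial of degree at most
  \<open>D\<close> would vanish to order \<open>m\<close> on \<open>K\<close>. By \<open>par\<close>
  its top form vanishes to order \<open>m'\<close> at all directions in \<open>G\<close>. These are
  points of a grid of side \<open>q^2\<close>, where \<open>par'\<close> contradicts the
  Schwartz-Zippel bound.\<close>

theorem kakeya_planes_multiplicity:
  fixes K :: "(nat \<Rightarrow> 'a::{finite,field}) set" and G :: "(nat \<Rightarrow> nat \<Rightarrow> 'a) set"
  assumes "finite K" "G \<subseteq> mats t 2"
    and planes: "\<And>B. B \<in> G \<Longrightarrow> \<exists>y. \<kappa> \<le> card {c \<in> vecs 2. plane_point t y B c \<in> K}"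
    and par: "\<And>w. w < m' \<Longrightarrow> (D - w) * card (UNIV :: 'a set) < (m - w) * \<kappa>"
    and par': "D * (card (UNIV :: 'a set) ^ 2) ^ t < card (UNIV :: 'a set) ^ 2 * (card G * m')"
  shows "card {\<alpha> \<in> box {..<t + 2} D. sum \<alpha> {..<t + 2} \<le> D}
    \<le> card K * card {j \<in> box {..<t + 2} D. sum j {..<t + 2} < m}"
proof (rule ccontr)
  let ?q = "card (UNIV :: 'a set)" and ?I = "{..<t + 2}"
  assume "\<not> ?thesis"
  then obtain p :: "(nat \<Rightarrow> nat) \<Rightarrow> 'a" where
    nz: "\<exists>\<alpha>\<in>{\<alpha> \<in> box ?I D. sum \<alpha> ?I \<le> D}. p \<alpha> \<noteq> 0"
    and supp: "\<And>\<alpha>. \<alpha> \<notin> {\<alpha> \<in> box ?I D. sum \<alpha> ?I \<le> D} \<Longrightarrow> p \<alpha> = 0"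
    and van: "\<And>a j. a \<in> K \<Longrightarrow> j \<in> {j \<in> box ?I D. sum j ?I < m} \<Longrightarrow> hasse ?I D p a j = 0"
    using exists_vanishing_polynomial[OF assms(1), of "{\<alpha> \<in> box ?I D. sum \<alpha> ?I \<le> D}"
        "{j \<in> box ?I D. sum j ?I < m}" ?I D]
    by (auto simp: finite_funs not_le)
  let ?A = "{\<alpha> \<in> box ?I D. p \<alpha> \<noteq> 0}"
  \<comment> \<open>The actual degree may be below \<open>D\<close>, and only the form of that
    degree is sure to be nonzero.\<close>
  define D' where "D' = Max ((\<lambda>\<alpha>. sum \<alpha> ?I) ` ?A)"
  have fin: "finite ((\<lambda>\<alpha>. sum \<alpha> ?I) ` ?A)" by (simp add: finite_funs)
  have "D' \<in> (\<lambda>\<alpha>. sum \<alpha> ?I) ` ?A" unfolding D'_def using fin nz by (intro Max_in) auto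
  then obtain \<alpha>0 where \<alpha>0: "\<alpha>0 \<in> box ?I D" "p \<alpha>0 \<noteq> 0" "sum \<alpha>0 ?I = D'" by auto
  have "D' \<le> D" using supp[of \<alpha>0] \<alpha>0 by auto
  have deg: "sum \<alpha> ?I \<le> D'" if "\<alpha> \<in> box ?I D" "p \<alpha> \<noteq> 0" for \<alpha>
    unfolding D'_def using fin that by (intro Max_ge) auto
  define T where "T = (\<lambda>(u, v). [:u, v:]) ` (UNIV :: ('a \<times> 'a) set)"
  have fin_T: "finite T" by (simp add: T_def)
  have card_T: "card T = ?q ^ 2"
    unfolding T_def by (subst card_image)
      (auto intro!: inj_onI simp: card_cartesian_product power2_eq_square simp flip: UNIV_Times_UNIV)
  let ?R = "top_form t D D' (\<lambda>\<alpha>. [:p \<alpha>:])"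
  have dir: "direction t ` G \<subseteq> funs {..<t} T"
    by (auto simp: direction_def funs_def T_def intro!: image_eqI[where x = "(_ :: 'a, _ :: 'a)"])
  have "card T * (\<Sum>x\<in>funs {..<t} T. if x \<in> direction t ` G then m' else 0) \<le> D' * card T ^ card {..<t}"
  proof (rule schwartz_zippel_multiplicity[OF finite_lessThan fin_T])
    show "sum \<alpha> {..<t} \<le> D'" if "?R \<alpha> \<noteq> 0" for \<alpha>
    proof (rule ccontr)
      assume "\<not> ?thesis"
      then have "?R \<alpha> = 0" unfolding top_form_def by (intro sum.neutral) auto
      with that show False by simp
    qed
    show "\<exists>\<alpha>\<in>box {..<t} D. ?R \<alpha> \<noteq> 0" by (rule top_form_nonzero) (use \<alpha>0 in auto)
    fix x j assume "x \<in> funs {..<t} T" and j: "j \<in> box {..<t} D"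
      and less: "sum j {..<t} < (if x \<in> direction t ` G then m' else 0)"
    then obtain B where B: "B \<in> G" "x = direction t B" by (auto split: if_splits)
    then obtain y where y: "\<kappa> \<le> card {c \<in> vecs 2. plane_point t y B c \<in> K}" using planes by blast
    have par_D': "(D' - w) * ?q < (m - w) * \<kappa>" if "w < m'" for w
      using par[OF that] mult_right_mono[of "D' - w" "D - w" ?q] \<open>D' \<le> D\<close> by linarith
    show "hasse {..<t} D ?R x j = 0"
      unfolding B(2)
    proof (rule hasse_top_form_direction[OF _ deg \<open>D' \<le> D\<close> y par_D' j])
      show "sum j {..<t} < m'" using less by (auto split: if_splits)
    qed (use van in blast)+
  qed
  moreover have "(\<Sum>x\<in>funs {..<t} T. if x \<in> direction t ` G then m' else 0) = card G * m'"
    using dir fin_T card_image[OF inj_on_subset[OF inj_on_direction assms(2)]]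
    by (simp add: sum.If_cases finite_funs Int_absorb1 flip: Collect_conj_eq)
  ultimately have "?q ^ 2 * (card G * m') \<le> D' * (?q ^ 2) ^ t" by (simp add: card_T)
  also have "\<dots> \<le> D * (?q ^ 2) ^ t" using \<open>D' \<le> D\<close> by simp
  finally show False using par' by simp
qed

section \<open>Counting monomials and choosing the parameters\<close>

lemma card_simplex:
  assumes "finite I" "D \<le> N"
  shows "card {\<alpha> \<in> box I N. sum \<alpha> I \<le> D} = (card I + D) choose card I"
  using assms
proof (induction I arbitrary: D rule: finite_induct)
  case empty
  then show ?case by simp
next
  case (insert i I)
  have sum_upd: "sum (\<alpha>(i := k)) (insert i I) = k + sum \<alpha> I" for \<alpha> :: "nat \<Rightarrow> nat" and k
    using insert.hyps by (simp add: sum.insert) (rule sum.cong, auto)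
  have indicator: "card {\<alpha> \<in> box J N. P \<alpha>} = (\<Sum>\<alpha>\<in>box J N. if P \<alpha> then 1 else 0)"
    if "finite J" for J and P :: "(nat \<Rightarrow> nat) \<Rightarrow> bool"
    using that by (simp add: sum.If_cases finite_funs Int_def)
  have "card {\<alpha> \<in> box (insert i I) N. sum \<alpha> (insert i I) \<le> D}
      = (\<Sum>\<alpha>\<in>box I N. \<Sum>k\<le>N. if k + sum \<alpha> I \<le> D then 1 else 0)"
    unfolding indicator[OF finite.insertI[OF insert.hyps(1)]] sum_funs_insert[OF insert.hyps(2)] sum_upd ..
  also have "\<dots> = (\<Sum>k\<le>N. card {\<alpha> \<in> box I N. k + sum \<alpha> I \<le> D})"
    by (subst sum.swap) (simp only: indicator[OF insert.hyps(1)])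
  also have "\<dots> = (\<Sum>k\<le>D. card {\<alpha> \<in> box I N. k + sum \<alpha> I \<le> D})"
    by (rule sum.mono_neutral_right) (use insert.prems in auto)
  also have "\<dots> = (\<Sum>k\<le>D. (card I + (D - k)) choose card I)"
  proof (rule sum.cong[OF refl])
    fix k assume "k \<in> {..D}"
    then have "{\<alpha> \<in> box I N. k + sum \<alpha> I \<le> D} = {\<alpha> \<in> box I N. sum \<alpha> I \<le> D - k}" by auto
    then show "card {\<alpha> \<in> box I N. k + sum \<alpha> I \<le> D} = (card I + (D - k)) choose card I"
      using insert.IH[of "D - k"] insert.prems by simp
  qed
  also have "\<dots> = (\<Sum>k\<le>D. (card I + k) choose card I)"
    by (rule sum.reindex_bij_witness[of _ "\<lambda>k. D - k" "\<lambda>k. D - k"]) auto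
  also have "\<dots> = (card (insert i I) + D) choose card (insert i I)"
    using insert.hyps by (simp add: choose_rising_sum)
  finally show ?case .
qed

text \<open>The right side is the product of the \<open>d\<close> factors \<open>D + 1\<close> to
  \<open>D + d\<close>, each at least \<open>D + 1\<close>.\<close>

lemma power_le_fact_times_binomial: "Suc D ^ d \<le> fact d * ((d + D) choose d)"
proof (induction d)
  case (Suc d)
  have "Suc D ^ Suc d \<le> (Suc (d + D)) * (fact d * ((d + D) choose d))"
    using mult_mono[OF _ Suc, of "Suc D" "Suc (d + D)"] by simp
  also have "\<dots> = fact d * (Suc (d + D) * ((d + D) choose d))" by (simp only: mult_ac)
  also have "\<dots> = fact (Suc d) * ((Suc d + D) choose Suc d)"
    by (simp only: Suc_times_binomial_eq fact_Suc of_nat_id add_Suc mult_ac)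
  finally show ?case .
qed simp

lemma finite_vecs [simp]: "finite (vecs n :: (nat \<Rightarrow> 'a::{finite,zero}) set)"
  by (simp add: vecs_eq_funs finite_funs)

lemma card_vecs: "card (vecs n :: (nat \<Rightarrow> 'a::{finite,zero}) set) = card (UNIV :: 'a set) ^ n"
  by (simp add: vecs_eq_funs card_funs)

lemma mats_Suc_bij:
  "bij_betw (\<lambda>(M, v). M(k := v)) (mats k n \<times> vecs n) (mats (Suc k) n :: (nat \<Rightarrow> nat \<Rightarrow> 'a::zero) set)"
  by (rule bij_betw_byWitness[where f' = "\<lambda>M. (M(k := (\<lambda>_. 0)), M k)"])
    (auto simp: mats_def vecs_def fun_eq_iff less_Suc_eq_le not_less_eq_eq)

lemma mats_0: "mats 0 n = {\<lambda>_ _. 0}"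
  by (auto simp: mats_def fun_eq_iff)

lemma finite_mats [simp]: "finite (mats k n :: (nat \<Rightarrow> nat \<Rightarrow> 'a::{finite,zero}) set)"
proof (induction k)
  case (Suc k)
  then show ?case
    using bij_betw_finite[OF mats_Suc_bij[of k n, where 'a = 'a]] by (simp add: finite_cartesian_product)
qed (simp add: mats_0)

lemma card_mats: "card (mats k n :: (nat \<Rightarrow> nat \<Rightarrow> 'a::{finite,zero}) set) = card (UNIV :: 'a set) ^ (k * n)"
proof (induction k)
  case (Suc k)
  then show ?case
    using bij_betw_same_card[OF mats_Suc_bij[of k n, where 'a = 'a]]
    by (simp add: card_cartesian_product card_vecs power_add mult.commute)
qed (simp add: mats_0)

lemma card_UNIV_field_ge_2: "2 \<le> card (UNIV :: 'a::{finite,field} set)"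
  using card_mono[of "UNIV :: 'a set" "{0, 1}"] by simp

text \<open>Written as \<open>(1 + u) ^ d\<close> with \<open>d * u \<le> 3 + 1 / 49\<close>, the
  power is at most \<open>exp (3 + 1 / 49)\<close>, and \<open>27 * 49 / 48 < 30\<close>. The bound
  \<open>d \<le> q\<close> controls the contribution of \<open>3 / q\<close>.\<close>

lemma power_inverse_sum_le_30:
  fixes \<eta> q :: real and d :: nat
  assumes "0 \<le> \<eta>" "d * \<eta> \<le> 1 / 50" "d \<le> q" "1 \<le> d"
  shows "(1 / (1 - \<eta>) + 3 / q) ^ d \<le> 30"
proof -
  have "\<eta> \<le> d * \<eta>" using assms mult_right_mono[of 1 "real d" \<eta>] by simp
  then have \<eta>: "\<eta> \<le> 1 / 50" using assms by simp
  define u where "u = \<eta> / (1 - \<eta>) + 3 / q"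
  have "1 / (1 - \<eta>) + 3 / q = 1 + u" using \<eta> by (simp add: u_def field_simps)
  also have "(1 + u) ^ d \<le> exp u ^ d"
    using assms \<eta> by (intro power_mono exp_ge_add_one_self) (simp add: u_def)
  also have "\<dots> = exp (d * u)" by (simp add: exp_of_nat_mult)
  also have "\<dots> \<le> exp (3 + 1 / 49)"
  proof -
    have "d * (3 / q) \<le> 3" using assms by (simp add: field_simps)
    moreover have "d * (\<eta> / (1 - \<eta>)) \<le> 1 / 49"
    proof -
      have "d * (\<eta> / (1 - \<eta>)) = (d * \<eta>) / (1 - \<eta>)" by simp
      also have "\<dots> \<le> (1 / 50) / (1 - 1 / 50)" using assms \<eta> by (intro frac_le) auto
      finally show ?thesis by simp
    qed
    ultimately show ?thesis by (simp add: u_def distrib_left)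
  qed
  also have "\<dots> = exp 1 ^ 3 * exp (1 / 49)"
    unfolding exp_add using exp_of_nat_mult[of 3 "1::real"] by simp
  also have "\<dots> \<le> 3 ^ 3 * (49 / 48)"
  proof (intro mult_mono power_mono exp_le)
    have "48 / 49 \<le> exp (- (1 / 49) :: real)" using exp_ge_add_one_self[of "- (1 / 49) :: real"] by simp
    then show "exp (1 / 49) \<le> (49 / 48 :: real)" by (simp add: exp_minus field_simps)
  qed auto
  finally show ?thesis by simp
qed

text \<open>The degree is about \<open>d * q^2\<close> and the order of vanishing about
  \<open>d * q / \<rho>\<close>. In the comparison of monomials with conditions both
  \<open>fact d\<close> and \<open>d ^ d\<close> cancel, which leaves
  \<open>q ^ d \<le> card K * (1 / \<rho> + 3 / q) ^ d\<close>.\<close>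

lemma kakeya_planes_half:
  fixes K :: "(nat \<Rightarrow> 'a::{finite,field}) set" and G :: "(nat \<Rightarrow> nat \<Rightarrow> 'a) set" and \<eta> :: real
  defines "q \<equiv> card (UNIV :: 'a set)"
  assumes "finite K" "G \<subseteq> mats t 2"
    and planes: "\<And>B. B \<in> G \<Longrightarrow> \<exists>y. (1 - \<eta>) * real q ^ 2 \<le> card {c \<in> vecs 2. plane_point t y B c \<in> K}"
    and \<eta>: "0 \<le> \<eta>" "(t + 2) * \<eta> \<le> 1 / 50" and "t + 2 \<le> q" and G: "q ^ (2 * t) \<le> 2 * card G"
  shows "real q ^ (t + 2) \<le> 30 * real (card K)"
proof -
  define d where "d = t + 2"
  have d: "2 \<le> d" "d \<le> q" using assms by (auto simp: d_def)
  have q: "0 < q" using d by simp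
  define \<rho> where "\<rho> = 1 - \<eta>"
  have "\<eta> \<le> d * \<eta>" using \<eta> mult_right_mono[of 1 "real d" \<eta>] d by simp
  moreover have "d * \<eta> \<le> 1 / 50" using \<eta> by (simp add: d_def add.commute)
  ultimately have \<rho>: "0 < \<rho>" by (simp add: \<rho>_def)
  define \<kappa> where "\<kappa> = nat \<lceil>\<rho> * real q ^ 2\<rceil>"
  have \<kappa>: "\<rho> * real q ^ 2 \<le> \<kappa>" by (simp add: \<kappa>_def of_nat_ceiling)
  \<comment> \<open>For every \<open>w < 2 * d\<close> the difference \<open>m - w\<close> exceeds
    \<open>d * q / \<rho>\<close>, so that \<open>(m - w) * \<kappa>\<close> exceeds
    \<open>d * q ^ 3\<close>.\<close>
  define m where "m = Suc (nat \<lfloor>d * (q / \<rho> + 2)\<rfloor>)"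
  have nonneg: "0 \<le> d * (q / \<rho> + 2)" using \<rho> by simp
  then have m: "real (m - 1) \<le> d * (q / \<rho> + 2)" "d * (q / \<rho> + 2) < m"
    by (auto simp: m_def) linarith+
  \<comment> \<open>The largest degree excluded by Schwartz-Zippel on the grid of side
    \<open>q^2\<close> for directions of density one half and multiplicity
    \<open>2 * d\<close>.\<close>
  define D where "D = d * q ^ 2 - 1"
  have D: "Suc D = d * q ^ 2" using d by (simp add: D_def)
  have "card {\<alpha> \<in> box {..<t + 2} D. sum \<alpha> {..<t + 2} \<le> D}
    \<le> card K * card {j \<in> box {..<t + 2} D. sum j {..<t + 2} < m}"
  proof (rule kakeya_planes_multiplicity[OF assms(2,3), of \<kappa> "2 * d"])
    show "\<exists>y. \<kappa> \<le> card {c \<in> vecs 2. plane_point t y B c \<in> K}" if B: "B \<in> G" for B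
    proof -
      obtain y where "(1 - \<eta>) * real q ^ 2 \<le> card {c \<in> vecs 2. plane_point t y B c \<in> K}"
        using planes[OF B] by blast
      then have "\<kappa> \<le> card {c \<in> vecs 2. plane_point t y B c \<in> K}"
        unfolding \<kappa>_def \<rho>_def by linarith
      then show ?thesis by blast
    qed
    show "(D - w) * card (UNIV :: 'a set) < (m - w) * \<kappa>" if w: "w < 2 * d" for w
    proof -
      have "2 * d \<le> d * (q / \<rho> + 2)" using \<rho> by (simp add: distrib_left)
      then have "w < m" using w m(2) by linarith
      have "real ((D - w) * q) \<le> D * q" by (intro of_nat_mono mult_right_mono) auto
      also have "\<dots> < real (d * q ^ 2) * q"
        using q unfolding of_nat_mult[of D q] D[symmetric] by (intro mult_strict_right_mono) auto
      also have "\<dots> = (d * (q / \<rho>)) * (\<rho> * real q ^ 2)" using \<rho> by (simp add: power2_eq_square)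
      also have "\<dots> \<le> (real m - w) * (\<rho> * real q ^ 2)"
        using m(2) w \<rho> by (intro mult_right_mono) (auto simp: distrib_left)
      also have "\<dots> \<le> (real m - w) * \<kappa>"
        using \<kappa> \<open>w < m\<close> by (intro mult_left_mono) auto
      also have "\<dots> = real ((m - w) * \<kappa>)" using \<open>w < m\<close> by (simp add: of_nat_diff)
      finally show ?thesis unfolding q_def[symmetric] by (simp only: of_nat_less_iff)
    qed
    have "0 < card G" using G q by (cases "card G") auto
    have "D * q ^ (2 * t) \<le> D * (2 * card G)" using G by simp
    also have "\<dots> < (d * q ^ 2) * (2 * card G)"
      using \<open>0 < card G\<close> by (simp flip: D)
    finally show "D * (card (UNIV :: 'a set) ^ 2) ^ t < card (UNIV :: 'a set) ^ 2 * (card G * (2 * d))"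
      unfolding q_def[symmetric] power_mult by (simp only: mult_ac)
  qed
  \<comment> \<open>The larger box lets \<open>card_simplex\<close> apply without a comparison of
    \<open>m\<close> and \<open>D\<close>.\<close>
  also have "card {j \<in> box {..<t + 2} D. sum j {..<t + 2} < m}
      \<le> card {j \<in> box {..<t + 2} (D + m). sum j {..<t + 2} \<le> m - 1}"
  proof (rule card_mono)
    have "box {..<t + 2} D \<subseteq> box {..<t + 2} (D + m)"
      by (auto simp: funs_def intro: trans_le_add1)
    then show "{j \<in> box {..<t + 2} D. sum j {..<t + 2} < m}
        \<subseteq> {j \<in> box {..<t + 2} (D + m). sum j {..<t + 2} \<le> m - 1}"
      unfolding m_def by fastforce
  qed (simp add: finite_funs)
  also have "\<dots> = (d + (m - 1)) choose d"
    by (subst card_simplex) (auto simp: d_def)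
  also have "card {\<alpha> \<in> box {..<t + 2} D. sum \<alpha> {..<t + 2} \<le> D} = (d + D) choose d"
    by (subst card_simplex) (auto simp: d_def)
  finally have "(d + D) choose d \<le> card K * ((d + (m - 1)) choose d)" by simp
  then have "fact d * ((d + D) choose d) \<le> card K * (((d + (m - 1)) choose d) * fact d)"
    by (simp add: mult_ac)
  also have "\<dots> \<le> card K * (d + (m - 1)) ^ d"
    by (intro mult_left_mono binomial_fact_pow) auto
  finally have "(d * q ^ 2) ^ d \<le> card K * (d + (m - 1)) ^ d"
    using power_le_fact_times_binomial[of D d] by (simp add: D)
  then have "real ((d * q ^ 2) ^ d) \<le> real (card K * (d + (m - 1)) ^ d)"
    by (simp only: of_nat_le_iff)
  also have "\<dots> \<le> card K * (d * (q / \<rho> + 3)) ^ d"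
    unfolding of_nat_mult of_nat_power using m(1)
    by (intro mult_left_mono power_mono) (auto simp: distrib_left)
  also have "d * (q / \<rho> + 3) = d * q * (1 / \<rho> + 3 / q)"
    using q by (simp add: field_simps)
  also have "card K * (d * q * (1 / \<rho> + 3 / q)) ^ d = (d * q) ^ d * (card K * (1 / \<rho> + 3 / q) ^ d)"
    by (simp add: power_mult_distrib)
  finally have "real (d * q) ^ d * q ^ d \<le> real (d * q) ^ d * (card K * (1 / \<rho> + 3 / q) ^ d)"
    by (simp add: power_mult_distrib power2_eq_square mult_ac)
  then have "real q ^ d \<le> card K * (1 / \<rho> + 3 / q) ^ d"
    using d q by (simp add: mult_le_cancel_left)
  also have "\<dots> \<le> real (card K) * 30"
    unfolding \<rho>_def using \<eta> d
    by (intro mult_left_mono power_inverse_sum_le_30) (auto simp: d_def add.commute)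
  finally show ?thesis by (simp add: d_def)
qed

section \<open>Enlarging the set of directions by translates\<close>

definition mat_add :: "(nat \<Rightarrow> nat \<Rightarrow> 'a::plus) \<Rightarrow> (nat \<Rightarrow> nat \<Rightarrow> 'a) \<Rightarrow> nat \<Rightarrow> nat \<Rightarrow> 'a" where
  "mat_add B h = (\<lambda>i l. B i l + h i l)"

text \<open>Averaging over \<open>h\<close>: each \<open>x\<close> in \<open>X\<close> lies in
  exactly \<open>card G\<close> translates, one for each \<open>h = x - B\<close> with
  \<open>B\<close> in \<open>G\<close>.\<close>

lemma exists_good_translate:
  fixes G X :: "(nat \<Rightarrow> nat \<Rightarrow> 'a::{finite,field}) set"
  assumes "G \<subseteq> mats t k" "X \<subseteq> mats t k"
  shows "\<exists>h\<in>mats t k. card X * card G \<le> card (X \<inter> mat_add h ` G) * card (mats t k :: (nat \<Rightarrow> nat \<Rightarrow> 'a) set)"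
proof (rule ccontr)
  let ?M = "mats t k :: (nat \<Rightarrow> nat \<Rightarrow> 'a) set"
  assume "\<not> ?thesis"
  then have less: "card (X \<inter> mat_add h ` G) * card ?M < card X * card G" if "h \<in> ?M" for h
    using that by (auto simp: not_le)
  have fin: "finite X" "finite G" using assms finite_subset[OF _ finite_mats] by blast+
  have "?M \<noteq> {}" by (auto simp: mats_def)
  have "(\<Sum>h\<in>?M. card (X \<inter> mat_add h ` G)) = (\<Sum>h\<in>?M. \<Sum>x\<in>X. if x \<in> mat_add h ` G then 1 else 0)"
    using fin by (simp add: sum.If_cases)
  also have "\<dots> = (\<Sum>x\<in>X. \<Sum>h\<in>?M. if x \<in> mat_add h ` G then 1 else 0)" by (rule sum.swap)
  also have "\<dots> = (\<Sum>x\<in>X. card G)"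
  proof (rule sum.cong[OF refl])
    fix x assume x: "x \<in> X"
    have "bij_betw (\<lambda>B i l. x i l - B i l) G {h \<in> ?M. x \<in> mat_add h ` G}"
    proof (rule bij_betw_byWitness[where f' = "\<lambda>B i l. x i l - B i l"])
      show "(\<lambda>B i l. x i l - B i l) ` G \<subseteq> {h \<in> ?M. x \<in> mat_add h ` G}"
      proof
        fix h assume "h \<in> (\<lambda>B i l. x i l - B i l) ` G"
        then obtain B where B: "B \<in> G" "h = (\<lambda>i l. x i l - B i l)" by blast
        have "x \<in> ?M" "B \<in> ?M" using x B assms by auto
        then have "h \<in> ?M" using B(2) by (simp add: mats_def)
        moreover have "x = mat_add h B" using B by (simp add: mat_add_def)
        ultimately show "h \<in> {h \<in> ?M. x \<in> mat_add h ` G}" using B by blast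
      qed
      show "(\<lambda>B i l. x i l - B i l) ` {h \<in> ?M. x \<in> mat_add h ` G} \<subseteq> G"
      proof
        fix C assume "C \<in> (\<lambda>B i l. x i l - B i l) ` {h \<in> ?M. x \<in> mat_add h ` G}"
        then obtain h B where "B \<in> G" "x = mat_add h B" "C = (\<lambda>i l. x i l - h i l)" by blast
        then have "C = B" by (simp add: mat_add_def)
        with \<open>B \<in> G\<close> show "C \<in> G" by simp
      qed
    qed (intro ballI ext, simp)+
    then have "card {h \<in> ?M. x \<in> mat_add h ` G} = card G" by (rule bij_betw_same_card[symmetric])
    then show "(\<Sum>h\<in>?M. if x \<in> mat_add h ` G then 1 else 0) = card G"
      by (simp add: sum.If_cases Int_def)
  qed
  finally have "(\<Sum>h\<in>?M. card (X \<inter> mat_add h ` G)) * card ?M = card ?M * (card X * card G)" by simp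
  moreover have "(\<Sum>h\<in>?M. card (X \<inter> mat_add h ` G)) * card ?M < (\<Sum>h\<in>?M. card X * card G)"
    unfolding sum_distrib_right using less \<open>?M \<noteq> {}\<close> by (intro sum_strict_mono) auto
  ultimately show False by simp
qed

text \<open>Greedy choice: by averaging, some translate covers at least the proportion
  \<open>card G / Q\<close> of what is still uncovered.\<close>

lemma exists_covering_translates:
  fixes G :: "(nat \<Rightarrow> nat \<Rightarrow> 'a::{finite,field}) set"
  assumes "G \<subseteq> mats t k"
  defines "Q \<equiv> card (mats t k :: (nat \<Rightarrow> nat \<Rightarrow> 'a) set)"
  shows "\<exists>H\<subseteq>mats t k. card H \<le> N \<and> finite H \<and>
    real (card (mats t k - (\<Union>h\<in>H. mat_add h ` G))) \<le> Q * (1 - card G / Q) ^ N"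
proof (induction N)
  case 0
  then show ?case by (intro exI[of _ "{}"]) (auto simp: Q_def)
next
  case (Suc N)
  then obtain H where H: "H \<subseteq> mats t k" "card H \<le> N" "finite H"
    "real (card (mats t k - (\<Union>h\<in>H. mat_add h ` G))) \<le> Q * (1 - card G / Q) ^ N" by blast
  define X where "X = mats t k - (\<Union>h\<in>H. mat_add h ` G)"
  have Q: "0 < Q" unfolding Q_def card_mats by (simp add: card_gt_0_iff)
  obtain h where h: "h \<in> mats t k" "card X * card G \<le> card (X \<inter> mat_add h ` G) * Q"
    using exists_good_translate[OF assms(1), of X] by (auto simp: X_def Q_def)
  have "card G \<le> Q" unfolding Q_def using assms(1) by (intro card_mono) auto
  have "real (card X) * card G \<le> card (X \<inter> mat_add h ` G) * Q"
    using h(2) by (simp only: of_nat_le_iff flip: of_nat_mult)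
  then have *: "card X * (card G / Q) \<le> card (X \<inter> mat_add h ` G)"
    using Q by (simp add: field_simps)
  have fin: "finite X" by (simp add: X_def)
  have "real (card (X - mat_add h ` G)) = real (card X) - real (card (X \<inter> mat_add h ` G))"
    using card_Diff_subset_Int[of X "mat_add h ` G"] fin card_mono[OF fin Int_lower1[of X "mat_add h ` G"]]
    by (simp add: of_nat_diff)
  also have "\<dots> \<le> card X * (1 - card G / Q)" using * by (simp add: right_diff_distrib)
  also have "\<dots> \<le> Q * (1 - card G / Q) ^ N * (1 - card G / Q)"
    using H(4) \<open>card G \<le> Q\<close> Q by (intro mult_right_mono) (auto simp: X_def)
  finally have "real (card (X - mat_add h ` G)) \<le> Q * (1 - card G / Q) ^ Suc N"
    by (simp add: mult_ac)
  moreover have "mats t k - (\<Union>h\<in>insert h H. mat_add h ` G) = X - mat_add h ` G"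
    by (auto simp: X_def)
  moreover have "card (insert h H) \<le> Suc N" using H(2,3) by (simp add: card_insert_if)
  ultimately show ?case using H h by (intro exI[of _ "insert h H"]) auto
qed

text \<open>The linear map that adds \<open>h\<close> to the direction of a plane and keeps the
  parameters of its points. It realises translates of the set of directions by images of
  \<open>K\<close> of no larger size.\<close>

definition shear :: "nat \<Rightarrow> (nat \<Rightarrow> nat \<Rightarrow> 'a::comm_ring_1) \<Rightarrow> (nat \<Rightarrow> 'a) \<Rightarrow> nat \<Rightarrow> 'a" where
  "shear t h z = (\<lambda>i. if i < t then z i + (h i 0 * z t + h i 1 * z (t + 1)) else z i)"

lemma shear_plane_point: "shear t h (plane_point t y B c) = plane_point t y (mat_add h B) c"
  by (auto simp: shear_def plane_point_def mat_add_def algebra_simps fun_eq_iff)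

text \<open>About \<open>1 / \<gamma>\<close> shears of \<open>K\<close>, with
  \<open>\<gamma>\<close> the density of \<open>G\<close>, together serve at least half of all
  directions. Their union has at most \<open>2 / \<gamma>\<close> times as many points as
  \<open>K\<close>, which turns the constant 30 into 60.\<close>

theorem kakeya_planes:
  fixes K :: "(nat \<Rightarrow> 'a::{finite,field}) set" and G :: "(nat \<Rightarrow> nat \<Rightarrow> 'a) set" and \<eta> :: real
  defines "q \<equiv> card (UNIV :: 'a set)"
  assumes "finite K" "G \<subseteq> mats t 2"
    and planes: "\<And>B. B \<in> G \<Longrightarrow> \<exists>y. (1 - \<eta>) * real q ^ 2 \<le> card {c \<in> vecs 2. plane_point t y B c \<in> K}"
    and \<eta>: "0 \<le> \<eta>" "(t + 2) * \<eta> \<le> 1 / 50" and "t + 2 \<le> q"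
  shows "real (card G) * real q ^ (t + 2) \<le> 60 * real (card K) * real q ^ (2 * t)"
proof (cases "card G = 0")
  case False
  define Q where "Q = card (mats t 2 :: (nat \<Rightarrow> nat \<Rightarrow> 'a) set)"
  have Q_eq: "Q = q ^ (2 * t)" by (simp add: Q_def card_mats q_def mult.commute)
  have q: "0 < q" using assms by simp
  then have Q: "0 < Q" by (simp add: Q_eq)
  have "card G \<le> Q" unfolding Q_def using assms by (intro card_mono) auto
  define \<gamma> where "\<gamma> = card G / Q"
  have \<gamma>: "0 < \<gamma>" "\<gamma> \<le> 1" using False Q \<open>card G \<le> Q\<close> by (auto simp: \<gamma>_def)
  \<comment> \<open>With this many translates the uncovered proportion is at most
    \<open>(1 - \<gamma>) ^ N \<le> exp (- 1) \<le> 1 / 2\<close>.\<close>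
  define N where "N = nat \<lceil>1 / \<gamma>\<rceil>"
  have N: "1 / \<gamma> \<le> N" "N \<le> 1 / \<gamma> + 1" using \<gamma> by (auto simp: N_def of_nat_ceiling)
  obtain H where H: "H \<subseteq> mats t 2" "card H \<le> N" "finite H"
    "real (card (mats t 2 - (\<Union>h\<in>H. mat_add h ` G))) \<le> Q * (1 - \<gamma>) ^ N"
    using exists_covering_translates[OF assms(3), of N] unfolding Q_def \<gamma>_def by blast
  define G' where "G' = (\<Union>h\<in>H. mat_add h ` G)"
  define K' where "K' = (\<Union>h\<in>H. shear t h ` K)"
  have G': "G' \<subseteq> mats t 2"
    using H(1) assms(3) unfolding G'_def mats_def mat_add_def by fastforce
  have "(1 - \<gamma>) ^ N \<le> exp (- \<gamma>) ^ N"
    using \<gamma> exp_ge_add_one_self[of "- \<gamma>"] by (intro power_mono) auto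
  also have "\<dots> = exp (- (N * \<gamma>))" by (simp add: exp_of_nat_mult[symmetric])
  also have "\<dots> \<le> exp (- 1)" using N(1) \<gamma> by (simp add: field_simps)
  also have "\<dots> \<le> 1 / 2" using exp_ge_add_one_self[of "1::real"] by (simp add: exp_minus field_simps)
  finally have "real (card (mats t 2 - G')) \<le> Q * (1 / 2)"
    using H(4) Q unfolding G'_def by (smt (verit) mult_left_mono of_nat_0_le_iff)
  moreover have "card (mats t 2 - G') = Q - card G'"
    unfolding Q_def using G' finite_subset[OF G'] by (intro card_Diff_subset) auto
  ultimately have half: "q ^ (2 * t) \<le> 2 * card G'" unfolding Q_eq[symmetric] by linarith
  have "finite K'" unfolding K'_def using H(3) assms(2) by blast
  have "real q ^ (t + 2) \<le> 30 * real (card K')"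
    unfolding q_def
  proof (rule kakeya_planes_half[OF \<open>finite K'\<close> G' _ \<eta>])
    fix B' assume "B' \<in> G'"
    then obtain h B where hB: "h \<in> H" "B \<in> G" "B' = mat_add h B" by (auto simp: G'_def)
    then obtain y where y: "(1 - \<eta>) * real q ^ 2 \<le> card {c \<in> vecs 2. plane_point t y B c \<in> K}"
      using planes by blast
    have "{c \<in> vecs 2. plane_point t y B c \<in> K} \<subseteq> {c \<in> vecs 2. plane_point t y B' c \<in> K'}"
      using hB shear_plane_point[of t h y B] by (auto simp: K'_def) (metis image_eqI)
    then have "card {c \<in> vecs 2. plane_point t y B c \<in> K} \<le> card {c \<in> vecs 2. plane_point t y B' c \<in> K'}"
      by (intro card_mono) auto
    then show "\<exists>y. (1 - \<eta>) * real (card (UNIV :: 'a set)) ^ 2 \<le> card {c \<in> vecs 2. plane_point t y B' c \<in> K'}"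
      using y unfolding q_def by (intro exI[of _ y]) linarith
  qed (use assms half in \<open>auto simp: q_def\<close>)
  also have "card K' \<le> N * card K"
  proof -
    have "card K' \<le> (\<Sum>h\<in>H. card (shear t h ` K))" unfolding K'_def by (rule card_UN_le[OF H(3)])
    also have "\<dots> \<le> (\<Sum>h\<in>H. card K)" by (intro sum_mono card_image_le assms)
    also have "\<dots> \<le> N * card K" using H(2) by simp
    finally show ?thesis .
  qed
  also have "30 * real (N * card K) = 30 * (N * real (card K))" by simp
  also have "\<dots> \<le> 30 * ((2 / \<gamma>) * card K)"
  proof -
    have "N \<le> 2 / \<gamma>" using N(2) \<gamma> by (simp add: field_simps)
    then show ?thesis by (intro mult_left_mono mult_right_mono) auto
  qed
  finally have "real q ^ (t + 2) * \<gamma> \<le> 60 * card K" using \<gamma> by (simp add: field_simps)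
  then have "real (card G) * real q ^ (t + 2) \<le> 60 * real (card K) * Q"
    using Q by (simp add: \<gamma>_def field_simps)
  then show ?thesis by (simp add: Q_eq)
qed simp


section \<open>Random linear maps\<close>

lemma mat_apply_in_vecs: "mat_apply k n M v \<in> vecs k"
  by (auto simp: mat_apply_def vecs_def)

lemma mat_apply_diff:
  fixes M :: "nat \<Rightarrow> nat \<Rightarrow> 'a::comm_ring_1"
  shows "mat_apply k n M (\<lambda>i. x i - y i) = (\<lambda>i. mat_apply k n M x i - mat_apply k n M y i)"
  by (auto simp: mat_apply_def right_diff_distrib sum_subtractf fun_eq_iff)

lemma card_eq_sum_fibers:
  assumes "finite A" "finite B" "f ` A \<subseteq> B"
  shows "(\<Sum>b\<in>B. card {a \<in> A. f a = b}) = card A"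
  using sum.group[OF assms, of "\<lambda>_. 1 :: nat"] by simp

text \<open>For a coordinate \<open>l\<close> with \<open>v l\<close> nonzero, adding
  \<open>w i / v l\<close> to column \<open>l\<close> shifts the value at \<open>v\<close> by
  \<open>w\<close>. So all \<open>q ^ k\<close> fibres of evaluation at \<open>v\<close> have equal
  size.\<close>

lemma card_mats_annihilating:
  fixes v :: "nat \<Rightarrow> 'a::{finite,field}"
  assumes "v \<in> vecs n" "v \<noteq> (\<lambda>_. 0)"
  shows "card {M \<in> mats k n. mat_apply k n M v = (\<lambda>_. 0)} * card (UNIV :: 'a set) ^ k
    = card (UNIV :: 'a set) ^ (k * n)"
proof -
  obtain l where l: "v l \<noteq> 0" using assms(2) by auto
  then have "l < n" using assms(1) by (auto simp: vecs_def not_le[symmetric])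
  have fiber: "card {M \<in> mats k n. mat_apply k n M v = w} = card {M \<in> mats k n. mat_apply k n M v = (\<lambda>_. 0)}"
    if w: "w \<in> vecs k" for w
  proof -
    define sh where "sh s M = (\<lambda>i j. if i < k \<and> j = l then M i j + s * w i / v l else M i j)" for s M
    have apply_sh: "mat_apply k n (sh s M) v = (\<lambda>i. mat_apply k n M v i + s * w i)" for s M
    proof
      fix i
      show "mat_apply k n (sh s M) v i = mat_apply k n M v i + s * w i"
      proof (cases "i < k")
        case True
        have "(\<Sum>j<n. sh s M i j * v j) = (\<Sum>j<n. M i j * v j + (if j = l then s * w i else 0))"
          using True l by (intro sum.cong) (auto simp: sh_def distrib_right)
        then show ?thesis using True \<open>l < n\<close> by (simp add: mat_apply_def sum.distrib)
      next
        case False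
        then show ?thesis using w by (simp add: mat_apply_def vecs_def)
      qed
    qed
    have inv: "sh s (sh s' M) = M" if "s + s' = 0" for s s' M
      using that by (auto simp: sh_def fun_eq_iff eq_neg_iff_add_eq_0[symmetric])
    have sh_mats: "sh s M \<in> mats k n" if "M \<in> mats k n" for s M
      using that \<open>l < n\<close> by (auto simp: sh_def mats_def)
    have "bij_betw (sh (- 1)) {M \<in> mats k n. mat_apply k n M v = w} {M \<in> mats k n. mat_apply k n M v = (\<lambda>_. 0)}"
      by (rule bij_betw_byWitness[where f' = "sh 1"]) (auto simp: inv apply_sh sh_mats)
    then show ?thesis by (rule bij_betw_same_card)
  qed
  have "card (mats k n :: (nat \<Rightarrow> nat \<Rightarrow> 'a) set)
      = (\<Sum>w\<in>vecs k. card {M \<in> mats k n. mat_apply k n M v = w})"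
    by (rule card_eq_sum_fibers[symmetric]) (auto simp: mat_apply_in_vecs)
  also have "\<dots> = (\<Sum>w\<in>(vecs k :: (nat \<Rightarrow> 'a) set). card {M \<in> mats k n. mat_apply k n M v = (\<lambda>_. 0)})"
    by (rule sum.cong) (auto simp: fiber)
  finally show ?thesis by (simp add: card_mats card_vecs mult.commute)
qed

text \<open>Distinct points have the same image under a random matrix with probability exactly
  \<open>q^(-k)\<close>, which gives the expected number of collisions.\<close>

lemma second_moment_fibers:
  fixes A :: "(nat \<Rightarrow> 'a::{finite,field}) set" and q :: real
  assumes "A \<subseteq> vecs n"
  defines "q \<equiv> real (card (UNIV :: 'a set))"
  shows "(\<Sum>M\<in>mats k n. \<Sum>z\<in>vecs k. (real (card {x \<in> A. mat_apply k n M x = z}) - card A / q ^ k)\<^sup>2)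
    \<le> card A * q ^ (k * n)"
proof -
  have fin: "finite A" using assms(1) finite_subset[OF _ finite_vecs] by blast
  have q: "2 \<le> q" using card_UNIV_field_ge_2[where 'a = 'a] by (simp add: q_def)
  let ?N = "\<lambda>M z. real (card {x \<in> A. mat_apply k n M x = z})"
  have N_sum: "(\<Sum>z\<in>vecs k. ?N M z) = card A" for M
    using card_eq_sum_fibers[OF fin finite_vecs, of "mat_apply k n M" k]
    by (simp add: mat_apply_in_vecs image_subset_iff flip: of_nat_sum)
  \<comment> \<open>Squared fibre sizes count ordered pairs with equal image, those with
    \<open>x = x'\<close> included.\<close>
  have N_sq: "(\<Sum>z\<in>vecs k. (?N M z)\<^sup>2) = card {(x, x') \<in> A \<times> A. mat_apply k n M x = mat_apply k n M x'}" for M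
  proof -
    let ?P = "{(x, x') \<in> A \<times> A. mat_apply k n M x = mat_apply k n M x'}"
    have "card ?P = (\<Sum>z\<in>vecs k. card {p \<in> ?P. mat_apply k n M (fst p) = z})"
    proof (rule card_eq_sum_fibers[symmetric])
      show "finite ?P" by (rule finite_subset[of _ "A \<times> A"]) (use fin in auto)
    qed (auto simp: mat_apply_in_vecs)
    also have "\<dots> = (\<Sum>z\<in>vecs k. card ({x \<in> A. mat_apply k n M x = z} \<times> {x \<in> A. mat_apply k n M x = z}))"
      by (intro sum.cong refl arg_cong[where f = card]) auto
    finally show ?thesis by (simp add: card_cartesian_product power2_eq_square)
  qed
  have coll: "real (card {M \<in> mats k n. mat_apply k n M x = mat_apply k n M x'})
      = q ^ (k * n) / q ^ k + (if x = x' then q ^ (k * n) - q ^ (k * n) / q ^ k else 0)"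
    if "x \<in> A" "x' \<in> A" for x x'
  proof (cases "x = x'")
    case True
    then show ?thesis by (simp add: card_mats q_def)
  next
    case False
    have v: "(\<lambda>i. x i - x' i) \<in> vecs n" "(\<lambda>i. x i - x' i) \<noteq> (\<lambda>_. 0)"
      using subsetD[OF assms(1) that(1)] subsetD[OF assms(1) that(2)] False
      by (auto simp: vecs_def fun_eq_iff)
    have "{M \<in> mats k n. mat_apply k n M x = mat_apply k n M x'}
        = {M \<in> mats k n. mat_apply k n M (\<lambda>i. x i - x' i) = (\<lambda>_. 0)}"
      by (auto simp: mat_apply_diff fun_eq_iff)
    then have "real (card {M \<in> mats k n. mat_apply k n M x = mat_apply k n M x'}) * q ^ k = q ^ (k * n)"
      using card_mats_annihilating[OF v, of k] by (simp add: q_def flip: of_nat_power of_nat_mult)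
    then show ?thesis using False q by (simp add: field_simps)
  qed
  have "(\<Sum>M\<in>mats k n. \<Sum>z\<in>vecs k. (?N M z)\<^sup>2)
      = (\<Sum>M\<in>mats k n. \<Sum>p\<in>A \<times> A. if mat_apply k n M (fst p) = mat_apply k n M (snd p) then 1 else 0)"
    using fin by (simp add: N_sq sum.If_cases Int_def case_prod_unfold mem_Times_iff conj_assoc)
  also have "\<dots> = (\<Sum>p\<in>A \<times> A. real (card {M \<in> mats k n. mat_apply k n M (fst p) = mat_apply k n M (snd p)}))"
    by (subst sum.swap) (simp add: sum.If_cases Int_def)
  also have "\<dots> = (\<Sum>p\<in>A \<times> A. q ^ (k * n) / q ^ k
      + (if fst p = snd p then q ^ (k * n) - q ^ (k * n) / q ^ k else 0))"
    by (intro sum.cong refl coll) auto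
  also have "\<dots> = (card A)\<^sup>2 * (q ^ (k * n) / q ^ k) + card A * (q ^ (k * n) - q ^ (k * n) / q ^ k)"
    using fin by (simp add: sum.distrib card_cartesian_product power2_eq_square
        sum.cartesian_product' sum.delta)
  finally have sq: "(\<Sum>M\<in>mats k n. \<Sum>z\<in>vecs k. (?N M z)\<^sup>2) = \<dots>" .
  have "(\<Sum>z\<in>vecs k. (?N M z - card A / q ^ k)\<^sup>2) = (\<Sum>z\<in>vecs k. (?N M z)\<^sup>2) - (card A)\<^sup>2 / q ^ k" for M
  proof -
    have "(\<Sum>z\<in>vecs k. (?N M z - card A / q ^ k)\<^sup>2)
        = (\<Sum>z\<in>vecs k. (?N M z)\<^sup>2 - 2 * (card A / q ^ k) * ?N M z + (card A / q ^ k)\<^sup>2)"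
      by (intro sum.cong refl) (simp add: power2_diff)
    also have "\<dots> = (\<Sum>z\<in>vecs k. (?N M z)\<^sup>2) - 2 * (card A / q ^ k) * card A
        + q ^ k * (card A / q ^ k)\<^sup>2"
      by (simp only: sum.distrib sum_subtractf sum_distrib_left[symmetric] N_sum)
        (simp add: card_vecs q_def)
    also have "q ^ k * (card A / q ^ k)\<^sup>2 = (card A / q ^ k) * card A"
      using q by (simp add: power2_eq_square)
    finally show ?thesis by (simp add: power2_eq_square)
  qed
  then have "(\<Sum>M\<in>mats k n. \<Sum>z\<in>vecs k. (?N M z - card A / q ^ k)\<^sup>2)
      = (\<Sum>M\<in>mats k n. \<Sum>z\<in>vecs k. (?N M z)\<^sup>2) - q ^ (k * n) * ((card A)\<^sup>2 / q ^ k)"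
    by (simp add: sum_subtractf card_mats q_def)
  also have "\<dots> = card A * (q ^ (k * n) - q ^ (k * n) / q ^ k)"
    unfolding sq by (simp add: mult_ac)
  also have "\<dots> \<le> card A * q ^ (k * n)"
    using q by (intro mult_left_mono) auto
  finally show ?thesis .
qed

text \<open>The image of a map that is not surjective is disjoint from one of its cosets, so at
  least half of the fibres are empty. Each such map contributes at least
  \<open>q ^ t / 2 * (q ^ (n - t))\<^sup>2\<close> to the second moment of the fibres of the whole
  space.\<close>

lemma card_not_surjective_le:
  assumes "t \<le> n"
  defines "q \<equiv> card (UNIV :: 'a::{finite,field} set)"
  shows "real (card (mats t n - surj_lin_maps t n :: (nat \<Rightarrow> nat \<Rightarrow> 'a) set)) * real q ^ (n - t) \<le> 2 * real q ^ (t * n)"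
proof -
  define X where "X = (mats t n - surj_lin_maps t n :: (nat \<Rightarrow> nat \<Rightarrow> 'a) set)"
  have q: "0 < q" unfolding q_def using card_UNIV_field_ge_2[where 'a = 'a] by linarith
  let ?N = "\<lambda>M z. real (card {x \<in> vecs n. mat_apply t n M x = (z :: nat \<Rightarrow> 'a)})"
  have mean: "real (card (vecs n :: (nat \<Rightarrow> 'a) set)) / real q ^ t = real q ^ (n - t)"
    using assms q by (simp add: card_vecs power_diff)
  have lower: "real q ^ t / 2 * (real q ^ (n - t))\<^sup>2 \<le> (\<Sum>z\<in>vecs t. (?N M z - real q ^ (n - t))\<^sup>2)"
    if M: "M \<in> X" for M
  proof -
    let ?Im = "mat_apply t n M ` vecs n"
    have Im: "?Im \<subseteq> vecs t" by (auto simp: mat_apply_in_vecs)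
    then obtain y where y: "y \<in> vecs t" "y \<notin> ?Im"
      using M by (auto simp: X_def surj_lin_maps_def)
    have "card ?Im \<le> card (vecs t - ?Im)"
    proof (rule card_inj_on_le[where f = "\<lambda>w i. w i - y i"])
      show "inj_on (\<lambda>w i. w i - y i) ?Im" by (auto simp: inj_on_def fun_eq_iff)
      show "(\<lambda>w i. w i - y i) ` ?Im \<subseteq> vecs t - ?Im"
      proof
        fix v assume "v \<in> (\<lambda>w i. w i - y i) ` ?Im"
        then obtain x where x: "x \<in> vecs n" "v = (\<lambda>i. mat_apply t n M x i - y i)" by auto
        have "v \<in> vecs t" unfolding x(2) using y(1) mat_apply_in_vecs[of t n M x] by (simp add: vecs_def)
        moreover have "v \<notin> ?Im"
        proof
          assume "v \<in> ?Im"
          then obtain x' where x': "x' \<in> vecs n" "v = mat_apply t n M x'" by auto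
          have "y = mat_apply t n M (\<lambda>i. x i - x' i)"
            using fun_cong[OF x(2)] unfolding mat_apply_diff x'(2)[symmetric] by (auto simp: fun_eq_iff)
          moreover have "(\<lambda>i. x i - x' i) \<in> vecs n" using x(1) x'(1) by (simp add: vecs_def)
          ultimately show False using y(2) by blast
        qed
        ultimately show "v \<in> vecs t - ?Im" by blast
      qed
    qed simp
    moreover have "card (vecs t - ?Im) = q ^ t - card ?Im"
      using Im by (simp add: card_Diff_subset card_vecs q_def)
    ultimately have half: "q ^ t \<le> 2 * card (vecs t - ?Im)" by linarith
    have "real q ^ t / 2 * (real q ^ (n - t))\<^sup>2 \<le> card (vecs t - ?Im) * (real q ^ (n - t))\<^sup>2"
      using half by (intro mult_right_mono) (simp_all flip: of_nat_power)
    also have "\<dots> = (\<Sum>z\<in>vecs t - ?Im. (?N M z - real q ^ (n - t))\<^sup>2)"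
    proof -
      have "(?N M z - real q ^ (n - t))\<^sup>2 = (real q ^ (n - t))\<^sup>2" if "z \<in> vecs t - ?Im" for z
      proof -
        have "{x \<in> vecs n. mat_apply t n M x = z} = {}" using that by auto
        then show ?thesis by (simp only: card.empty) simp
      qed
      then show ?thesis by simp
    qed
    also have "\<dots> \<le> (\<Sum>z\<in>vecs t. (?N M z - real q ^ (n - t))\<^sup>2)"
      by (rule sum_mono2) auto
    finally show ?thesis .
  qed
  have "card X * (real q ^ t / 2 * (real q ^ (n - t))\<^sup>2)
      \<le> (\<Sum>M\<in>X. \<Sum>z\<in>vecs t. (?N M z - real q ^ (n - t))\<^sup>2)"
    using sum_mono[of X, OF lower] by simp
  also have "\<dots> \<le> (\<Sum>M\<in>mats t n. \<Sum>z\<in>vecs t. (?N M z - real q ^ (n - t))\<^sup>2)"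
    by (rule sum_mono2) (auto simp: X_def intro: sum_nonneg)
  also have "\<dots> \<le> real q ^ n * real q ^ (t * n)"
    using second_moment_fibers[of "vecs n :: (nat \<Rightarrow> 'a) set" n t]
    unfolding q_def[symmetric] mean by (simp add: card_vecs q_def)
  also have "real q ^ n = real q ^ t * real q ^ (n - t)"
    using assms by (simp flip: power_add)
  finally have "(real q ^ t * real q ^ (n - t)) * (card X * real q ^ (n - t))
      \<le> (real q ^ t * real q ^ (n - t)) * (2 * real q ^ (t * n))"
    by (simp add: power2_eq_square mult_ac)
  then show ?thesis using q by (simp add: X_def mult_le_cancel_left)
qed

section \<open>Spreading heavy fibres over planes\<close>

lemma many_rich_extensions:
  fixes A :: "(nat \<Rightarrow> 'a::{finite,field}) set" and q \<epsilon> \<eta> \<theta> :: real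
  defines "q \<equiv> real (card (UNIV :: 'a set))"
  assumes "A \<subseteq> vecs n" "0 < \<epsilon>" "0 < \<eta>" "2 * q\<^sup>2 \<le> \<eta> * \<epsilon>\<^sup>2 * card A"
    and \<theta>: "\<theta> \<le> (1 - \<epsilon>) * (card A / q\<^sup>2)"
  shows "q ^ (2 * n) \<le> 2 * card {U \<in> mats 2 n.
    (1 - \<eta>) * q\<^sup>2 \<le> card {c \<in> vecs 2. \<theta> \<le> card {x \<in> A. mat_apply 2 n U x = c}}}"
proof -
  have q: "2 \<le> q" using card_UNIV_field_ge_2[where 'a = 'a] by (simp add: q_def)
  define a where "a = real (card A)"
  have "0 < \<eta> * \<epsilon>\<^sup>2 * a" using assms(5) q unfolding a_def
    by (smt (verit) zero_less_power)
  then have "a \<noteq> 0" by auto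
  then have a: "0 < a" by (simp add: a_def)
  let ?N = "\<lambda>U c. real (card {x \<in> A. mat_apply 2 n U x = c})"
  let ?rich = "\<lambda>U. {c \<in> vecs 2. \<theta> \<le> ?N U c}"
  let ?good = "{U \<in> mats 2 n. (1 - \<eta>) * q\<^sup>2 \<le> card (?rich U)}"
  define X where "X = mats 2 n - ?good"
  \<comment> \<open>A map \<open>U\<close> that is not good leaves more than
    \<open>\<eta> * q\<^sup>2\<close> points whose fibres fall short of the mean by the proportion
    \<open>\<epsilon>\<close>. Comparison with the second moment shows that at most half of all
    \<open>U\<close> are of this kind.\<close>
  have lower: "\<eta> * q\<^sup>2 * (\<epsilon> * (a / q\<^sup>2))\<^sup>2 \<le> (\<Sum>c\<in>vecs 2. (?N U c - a / q\<^sup>2)\<^sup>2)" if U: "U \<in> X" for U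
  proof -
    have "card (vecs 2 - ?rich U) = card (vecs 2 :: (nat \<Rightarrow> 'a) set) - card (?rich U)"
      by (intro card_Diff_subset) auto
    moreover have "card (?rich U) \<le> card (vecs 2 :: (nat \<Rightarrow> 'a) set)" by (intro card_mono) auto
    ultimately have "real (card (vecs 2 - ?rich U)) = q\<^sup>2 - card (?rich U)"
      by (simp add: card_vecs q_def of_nat_diff)
    moreover have "card (?rich U) < (1 - \<eta>) * q\<^sup>2" using U by (auto simp: X_def not_le)
    ultimately have "\<eta> * q\<^sup>2 \<le> card (vecs 2 - ?rich U)" by (simp add: left_diff_distrib)
    then have "\<eta> * q\<^sup>2 * (\<epsilon> * (a / q\<^sup>2))\<^sup>2 \<le> card (vecs 2 - ?rich U) * (\<epsilon> * (a / q\<^sup>2))\<^sup>2"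
      by (intro mult_right_mono) auto
    also have "\<dots> = (\<Sum>c\<in>vecs 2 - ?rich U. (\<epsilon> * (a / q\<^sup>2))\<^sup>2)" by simp
    also have "\<dots> \<le> (\<Sum>c\<in>vecs 2 - ?rich U. (?N U c - a / q\<^sup>2)\<^sup>2)"
    proof (rule sum_mono)
      fix c assume "c \<in> vecs 2 - ?rich U"
      then have "?N U c < \<theta>" by auto
      then have "\<epsilon> * (a / q\<^sup>2) \<le> a / q\<^sup>2 - ?N U c"
        using \<theta> unfolding a_def left_diff_distrib mult_1 by linarith
      then have "(\<epsilon> * (a / q\<^sup>2))\<^sup>2 \<le> (a / q\<^sup>2 - ?N U c)\<^sup>2"
        using assms(3) a q by (intro power_mono) auto
      then show "(\<epsilon> * (a / q\<^sup>2))\<^sup>2 \<le> (?N U c - a / q\<^sup>2)\<^sup>2" by (simp add: power2_commute)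
    qed
    also have "\<dots> \<le> (\<Sum>c\<in>vecs 2. (?N U c - a / q\<^sup>2)\<^sup>2)" by (rule sum_mono2) auto
    finally show ?thesis .
  qed
  have "card X * (\<eta> * q\<^sup>2 * (\<epsilon> * (a / q\<^sup>2))\<^sup>2) \<le> (\<Sum>U\<in>X. \<Sum>c\<in>vecs 2. (?N U c - a / q\<^sup>2)\<^sup>2)"
    using sum_mono[of X, OF lower] by simp
  also have "\<dots> \<le> (\<Sum>U\<in>mats 2 n. \<Sum>c\<in>vecs 2. (?N U c - a / q\<^sup>2)\<^sup>2)"
    by (rule sum_mono2) (auto simp: X_def intro: sum_nonneg)
  also have "\<dots> \<le> a * q ^ (2 * n)"
    using second_moment_fibers[OF assms(2), of 2] by (simp add: q_def a_def)
  also have "\<eta> * q\<^sup>2 * (\<epsilon> * (a / q\<^sup>2))\<^sup>2 = a * (\<eta> * \<epsilon>\<^sup>2 * a / q\<^sup>2)"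
    using q by (simp add: power2_eq_square)
  finally have "a * (card X * (\<eta> * \<epsilon>\<^sup>2 * a / q\<^sup>2)) \<le> a * q ^ (2 * n)" by (simp add: mult_ac)
  then have "card X * (\<eta> * \<epsilon>\<^sup>2 * a / q\<^sup>2) \<le> q ^ (2 * n)" using a by (rule mult_left_le_imp_le)
  moreover have "2 \<le> \<eta> * \<epsilon>\<^sup>2 * a / q\<^sup>2" using assms(5) q by (simp add: a_def pos_le_divide_eq)
  then have "real (card X) * 2 \<le> card X * (\<eta> * \<epsilon>\<^sup>2 * a / q\<^sup>2)" by (intro mult_left_mono) auto
  ultimately have X: "real (card X) * 2 \<le> q ^ (2 * n)" by linarith
  have "card X = card (mats 2 n :: (nat \<Rightarrow> nat \<Rightarrow> 'a) set) - card ?good"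
    unfolding X_def by (intro card_Diff_subset) auto
  moreover have "card ?good \<le> card (mats 2 n :: (nat \<Rightarrow> nat \<Rightarrow> 'a) set)" by (intro card_mono) auto
  ultimately have "real (card X) = q ^ (2 * n) - card ?good"
    by (simp add: card_mats q_def of_nat_diff)
  then show ?thesis using X by simp
qed

text \<open>The rows of \<open>L + B U\<close> above those of \<open>U\<close>: the map sends
  \<open>x\<close> to the point with parameters \<open>U x\<close> on the plane of direction
  \<open>B\<close> through \<open>(L x, 0, 0)\<close>. For fixed \<open>B\<close> the pair can be
  recovered, so counts of pairs pass to counts of maps.\<close>

definition stack ::
    "nat \<Rightarrow> (nat \<Rightarrow> nat \<Rightarrow> 'a::comm_ring_1) \<Rightarrow> (nat \<Rightarrow> nat \<Rightarrow> 'a) \<times> (nat \<Rightarrow> nat \<Rightarrow> 'a) \<Rightarrow> nat \<Rightarrow> nat \<Rightarrow> 'a" where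
  "stack t B = (\<lambda>(L, U) i j. if i < t then L i j + (B i 0 * U 0 j + B i 1 * U 1 j)
    else if i < t + 2 then U (i - t) j else 0)"

lemma stack_in_mats:
  "L \<in> mats t n \<Longrightarrow> U \<in> mats 2 n \<Longrightarrow> stack t B (L, U) \<in> mats (t + 2) n"
  by (auto simp: mats_def stack_def)

lemma mat_apply_stack:
  "mat_apply (t + 2) n (stack t B (L, U)) x
    = plane_point t (mat_apply t n L x) B (mat_apply 2 n U x)"
  by (auto simp: mat_apply_def stack_def plane_point_def fun_eq_iff distrib_right sum.distrib
      sum_distrib_left mult.assoc)

lemma inj_on_stack: "inj_on (stack t B) (mats t n \<times> mats 2 n)"
proof (rule inj_onI, clarify)
  fix L U L' U' :: "nat \<Rightarrow> nat \<Rightarrow> 'a"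
  assume m: "L \<in> mats t n" "U \<in> mats 2 n" "L' \<in> mats t n" "U' \<in> mats 2 n"
    and eq: "stack t B (L, U) = stack t B (L', U')"
  have eq': "stack t B (L, U) i j = stack t B (L', U') i j" for i j using eq by simp
  have U: "U = U'"
  proof (intro ext)
    fix i j
    show "U i j = U' i j"
      using eq'[of "i + t" j] m by (cases "i < 2") (auto simp: stack_def mats_def not_less)
  qed
  have "L = L'"
  proof (intro ext)
    fix i j
    show "L i j = L' i j"
      using eq'[of i j] m U by (cases "i < t") (auto simp: stack_def mats_def not_less)
  qed
  with U show "L = L' \<and> U = U'" by simp
qed

lemma plane_point_eq_iff:
  assumes "y \<in> vecs t" "y' \<in> vecs t" "c \<in> vecs 2" "c' \<in> vecs 2"
  shows "plane_point t y B c = plane_point t y' B c' \<longleftrightarrow> y = y' \<and> c = c'"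
proof
  assume eq: "plane_point t y B c = plane_point t y' B c'"
  have eq': "plane_point t y B c i = plane_point t y' B c' i" for i using eq by simp
  have c: "c = c'"
  proof
    fix i show "c i = c' i"
      using eq'[of "i + t"] assms by (cases "i < 2") (auto simp: plane_point_def vecs_def not_less)
  qed
  have "y = y'"
  proof
    fix i show "y i = y' i"
      using eq'[of i] c assms by (cases "i < t") (auto simp: plane_point_def vecs_def not_less)
  qed
  with c show "y = y' \<and> c = c'" by simp
qed simp

text \<open>Chebyshev's inequality summed over all maps: each counted point contributes at least the
  square of \<open>\<sigma>\<close> times the mean to the second moment.\<close>

lemma sum_card_rich_le:
  fixes S :: "(nat \<Rightarrow> 'a::{finite,field}) set" and q \<sigma> :: real
  defines "q \<equiv> real (card (UNIV :: 'a set))"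
  assumes "S \<subseteq> vecs n" "S \<noteq> {}" "0 < \<sigma>"
  shows "\<sigma>\<^sup>2 * card S * (\<Sum>M\<in>mats d n. real (card {z \<in> vecs d.
      (1 + \<sigma>) * (card S / q ^ d) \<le> card {x \<in> S. mat_apply d n M x = z}})) \<le> q ^ (2 * d) * q ^ (d * n)"
proof -
  have q: "2 \<le> q" using card_UNIV_field_ge_2[where 'a = 'a] by (simp add: q_def)
  have fin: "finite S" using assms(2) finite_subset[OF _ finite_vecs] by blast
  define s where "s = real (card S)"
  have s: "0 < s" using fin assms(3) by (simp add: s_def card_gt_0_iff)
  let ?N = "\<lambda>M z. real (card {x \<in> S. mat_apply d n M x = z})"
  let ?K = "\<lambda>M. {z \<in> vecs d. (1 + \<sigma>) * (s / q ^ d) \<le> ?N M z}"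
  have "card (?K M) * (\<sigma> * (s / q ^ d))\<^sup>2 \<le> (\<Sum>z\<in>vecs d. (?N M z - s / q ^ d)\<^sup>2)" for M
  proof -
    have "card (?K M) * (\<sigma> * (s / q ^ d))\<^sup>2 = (\<Sum>z\<in>?K M. (\<sigma> * (s / q ^ d))\<^sup>2)" by simp
    also have "\<dots> \<le> (\<Sum>z\<in>?K M. (?N M z - s / q ^ d)\<^sup>2)"
    proof (rule sum_mono)
      fix z assume "z \<in> ?K M"
      then have "s / q ^ d + \<sigma> * (s / q ^ d) \<le> ?N M z" by (simp add: distrib_right add_divide_distrib)
      then show "(\<sigma> * (s / q ^ d))\<^sup>2 \<le> (?N M z - s / q ^ d)\<^sup>2"
        using assms(4) s q by (intro power_mono) auto
    qed
    also have "\<dots> \<le> (\<Sum>z\<in>vecs d. (?N M z - s / q ^ d)\<^sup>2)" by (rule sum_mono2) auto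
    finally show ?thesis .
  qed
  then have "(\<Sum>M\<in>mats d n. card (?K M) * (\<sigma> * (s / q ^ d))\<^sup>2)
      \<le> (\<Sum>M\<in>mats d n. \<Sum>z\<in>vecs d. (?N M z - s / q ^ d)\<^sup>2)"
    by (intro sum_mono)
  also have "\<dots> \<le> s * q ^ (d * n)"
    using second_moment_fibers[OF assms(2), of d] by (simp add: q_def s_def)
  finally have "(\<Sum>M\<in>mats d n. real (card (?K M))) * (\<sigma> * (s / q ^ d))\<^sup>2 \<le> s * q ^ (d * n)"
    by (simp only: sum_distrib_right)
  moreover have "k * (\<sigma> * (s / q ^ d))\<^sup>2 = s * (\<sigma>\<^sup>2 * s * k) / q ^ (2 * d)" for k
    by (simp add: power2_eq_square power_add mult_2)
  ultimately have "s * (\<sigma>\<^sup>2 * s * (\<Sum>M\<in>mats d n. real (card (?K M)))) / q ^ (2 * d) \<le> s * q ^ (d * n)"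
    by (simp only:)
  then have "s * (\<sigma>\<^sup>2 * s * (\<Sum>M\<in>mats d n. real (card (?K M)))) \<le> s * (q ^ (2 * d) * q ^ (d * n))"
    using q by (simp add: pos_divide_le_eq mult_ac)
  then show ?thesis using s by (simp add: s_def mult_le_cancel_left)
qed

text \<open>Double counting of triples \<open>(L, U, B)\<close>: for a bad \<open>L\<close> and at
  least half of all \<open>U\<close>, every \<open>B\<close> is a direction in which
  \<open>K M\<close> almost contains a plane, where \<open>M = stack t B (L, U)\<close>. For each
  \<open>M\<close>, \<open>kakeya_planes\<close> bounds the number of such \<open>B\<close> by the
  size of \<open>K M\<close>, and \<open>sum_card_rich_le\<close> bounds the sum of these
  sizes.\<close>

lemma card_heavy_fiber_maps_le:
  fixes S :: "(nat \<Rightarrow> 'a::{finite,field}) set" and q \<tau> \<delta> :: real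
  defines "q \<equiv> real (card (UNIV :: 'a set))"
  assumes S: "S \<subseteq> vecs n" "q ^ (t + 3) \<le> card S" and "1 < \<tau>" "0 < \<delta>" "\<delta> \<le> 1 / 10"
    and q_ge: "n * (1 + \<tau>) \<le> q * ((\<tau> - sqrt \<tau>)\<^sup>2 * \<delta>\<^sup>2)" and "n \<le> q" "t + 2 \<le> n"
  shows "real n * real (card {L \<in> mats t n. \<exists>y\<in>vecs t.
      (1 + \<tau>) * (card S / q ^ t) \<le> card {x \<in> S. mat_apply t n L x = y}}) \<le> 120 * \<delta>\<^sup>2 * q ^ (t * n)"
proof -
  have q: "2 \<le> q" using card_UNIV_field_ge_2[where 'a = 'a] by (simp add: q_def)
  have n: "0 < n" using assms by simp
  define s where "s = real (card S)"
  have "0 < q ^ (t + 3)" using q by simp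
  then have s: "0 < s" "q ^ (t + 3) \<le> s" using S(2) by (simp_all add: s_def)
  then have "S \<noteq> {}" by (auto simp: s_def)
  define \<sigma> where "\<sigma> = sqrt \<tau>"
  have \<sigma>: "1 < \<sigma>" "\<sigma>\<^sup>2 = \<tau>" using assms by (auto simp: \<sigma>_def)
  have \<sigma>\<tau>: "\<sigma> < \<tau>" using \<sigma> mult_strict_right_mono[of 1 \<sigma> \<sigma>] by (simp add: power2_eq_square)
  let ?d = "t + 2"
  \<comment> \<open>\<open>\<epsilon>\<close> solves
    \<open>(1 - \<epsilon>) * (1 + \<tau>) = 1 + \<sigma>\<close>, so the fraction
    \<open>1 - \<epsilon>\<close> of the mean in a heavy fibre reaches \<open>\<theta>\<close>.
    \<open>\<eta>\<close> gives
    \<open>(t + 2) * \<eta> \<le> 2 * \<delta>\<^sup>2 \<le> 1 / 50\<close>, as the Kakeya bound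
    requires, and makes \<open>q_ge\<close> the condition of
    \<open>many_rich_extensions\<close>.\<close>
  define \<theta> where "\<theta> = (1 + \<sigma>) * (s / q ^ ?d)"
  define \<eta> where "\<eta> = 2 * \<delta>\<^sup>2 / n"
  define \<epsilon> where "\<epsilon> = (\<tau> - \<sigma>) / (1 + \<tau>)"
  have \<eta>: "0 < \<eta>" using n assms by (simp add: \<eta>_def)
  have \<epsilon>: "0 < \<epsilon>" "1 - \<epsilon> = (1 + \<sigma>) / (1 + \<tau>)" using \<sigma>\<tau> assms by (auto simp: \<epsilon>_def field_simps)
  define bad where "bad = {L \<in> mats t n. \<exists>y\<in>vecs t. (1 + \<tau>) * (s / q ^ t) \<le> card {x \<in> S. mat_apply t n L x = y}}"
  define rich where "rich L U y = {c \<in> vecs 2. \<theta> \<le> card {x \<in> S. mat_apply t n L x = y \<and> mat_apply 2 n U x = c}}"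
    for L U y
  define W where "W = (SIGMA L:bad. {U \<in> mats 2 n. \<exists>y\<in>vecs t. (1 - \<eta>) * q\<^sup>2 \<le> card (rich L U y)})"
  define K where "K M = {z \<in> vecs ?d. \<theta> \<le> card {x \<in> S. mat_apply ?d n M x = z}}" for M
  define G where "G M = {B \<in> mats t 2. \<exists>y. (1 - \<eta>) * q\<^sup>2 \<le> card {c \<in> vecs 2. plane_point t y B c \<in> K M}}" for M
  have fin_bad: "finite bad" by (simp add: bad_def)
  have W_sub: "W \<subseteq> mats t n \<times> mats 2 n" by (auto simp: W_def bad_def)

  have "q ^ (2 * n) \<le> 2 * card {U \<in> mats 2 n. \<exists>y\<in>vecs t. (1 - \<eta>) * q\<^sup>2 \<le> card (rich L U y)}"
    if L: "L \<in> bad" for L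
  proof -
    obtain y where y: "y \<in> vecs t" "(1 + \<tau>) * (s / q ^ t) \<le> card {x \<in> S. mat_apply t n L x = y}"
      using L by (auto simp: bad_def)
    define A where "A = {x \<in> S. mat_apply t n L x = y}"
    have A: "(1 + \<tau>) * (s / q ^ t) \<le> card A" using y by (simp add: A_def)
    have "q ^ 3 \<le> s / q ^ t" using s q by (simp add: field_simps power_add)
    then have "(1 + \<tau>) * q ^ 3 \<le> card A"
      using A mult_left_mono[of "q ^ 3" "s / q ^ t" "1 + \<tau>"] assms by linarith
    then have "\<eta> * \<epsilon>\<^sup>2 * ((1 + \<tau>) * q ^ 3) \<le> \<eta> * \<epsilon>\<^sup>2 * card A"
      using \<eta> by (intro mult_left_mono) auto
    moreover have "2 * q\<^sup>2 \<le> \<eta> * \<epsilon>\<^sup>2 * ((1 + \<tau>) * q ^ 3)"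
    proof -
      have "1 \<le> q * ((\<tau> - \<sigma>)\<^sup>2 * \<delta>\<^sup>2) / (n * (1 + \<tau>))"
        using q_ge n assms by (simp add: \<sigma>_def pos_le_divide_eq)
      then have "2 * q\<^sup>2 * 1 \<le> 2 * q\<^sup>2 * (q * ((\<tau> - \<sigma>)\<^sup>2 * \<delta>\<^sup>2) / (n * (1 + \<tau>)))"
        using q by (intro mult_left_mono) auto
      also have "\<dots> = \<eta> * \<epsilon>\<^sup>2 * ((1 + \<tau>) * q ^ 3)"
        using n assms by (simp add: \<eta>_def \<epsilon>_def power2_eq_square power3_eq_cube)
      finally show ?thesis by simp
    qed
    ultimately have *: "2 * q\<^sup>2 \<le> \<eta> * \<epsilon>\<^sup>2 * card A" by linarith
    have "\<theta> = (1 - \<epsilon>) * ((1 + \<tau>) * (s / q ^ t) / q\<^sup>2)"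
      using assms by (simp add: \<theta>_def \<epsilon>(2) power_add power2_eq_square)
    also have "\<dots> \<le> (1 - \<epsilon>) * (card A / q\<^sup>2)"
      using A \<epsilon>(2) \<sigma> assms q by (intro mult_left_mono divide_right_mono) auto
    finally have "q ^ (2 * n) \<le> 2 * card {U \<in> mats 2 n.
        (1 - \<eta>) * q\<^sup>2 \<le> card {c \<in> vecs 2. \<theta> \<le> card {x \<in> A. mat_apply 2 n U x = c}}}"
      using many_rich_extensions[of A n \<epsilon> \<eta> \<theta>] S(1) \<epsilon>(1) \<eta> * unfolding q_def A_def by auto
    also have "{U \<in> mats 2 n. (1 - \<eta>) * q\<^sup>2 \<le> card {c \<in> vecs 2. \<theta> \<le> card {x \<in> A. mat_apply 2 n U x = c}}}
        \<subseteq> {U \<in> mats 2 n. \<exists>y\<in>vecs t. (1 - \<eta>) * q\<^sup>2 \<le> card (rich L U y)}"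
      using y(1) by (auto simp: A_def rich_def conj_assoc)
    then have "card {U \<in> mats 2 n. (1 - \<eta>) * q\<^sup>2 \<le> card {c \<in> vecs 2. \<theta> \<le> card {x \<in> A. mat_apply 2 n U x = c}}}
        \<le> card {U \<in> mats 2 n. \<exists>y\<in>vecs t. (1 - \<eta>) * q\<^sup>2 \<le> card (rich L U y)}"
      by (intro card_mono) auto
    finally show ?thesis by simp
  qed
  then have "(\<Sum>L\<in>bad. q ^ (2 * n))
      \<le> (\<Sum>L\<in>bad. real (2 * card {U \<in> mats 2 n. \<exists>y\<in>vecs t. (1 - \<eta>) * q\<^sup>2 \<le> card (rich L U y)}))"
    by (intro sum_mono)
  also have "\<dots> = 2 * card W"
    unfolding W_def using fin_bad by (subst card_SigmaI) (auto simp: sum_distrib_left)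
  finally have card_W: "card bad * q ^ (2 * n) \<le> 2 * card W" by simp

  \<comment> \<open>Over a plane point the fibre of the stacked map consists of the \<open>x\<close>
    in \<open>S\<close> with \<open>L x = y\<close> and \<open>U x = c\<close>, whatever
    \<open>B\<close> is. So one pair \<open>(L, U)\<close> serves all directions at once.\<close>
  have stack_G: "B \<in> G (stack t B p)" if p: "p \<in> W" and B: "B \<in> mats t 2" for B p
  proof -
    obtain L U y where LU: "p = (L, U)" "U \<in> mats 2 n" "y \<in> vecs t" "(1 - \<eta>) * q\<^sup>2 \<le> card (rich L U y)"
      using p by (auto simp: W_def)
    have "rich L U y \<subseteq> {c \<in> vecs 2. plane_point t y B c \<in> K (stack t B p)}"
    proof
      fix c assume c: "c \<in> rich L U y"
      then have "c \<in> vecs 2" by (simp add: rich_def)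
      have "{x \<in> S. mat_apply ?d n (stack t B p) x = plane_point t y B c}
          = {x \<in> S. mat_apply t n L x = y \<and> mat_apply 2 n U x = c}"
        unfolding LU(1) mat_apply_stack using LU(3) \<open>c \<in> vecs 2\<close>
        by (simp add: plane_point_eq_iff mat_apply_in_vecs)
      moreover have "plane_point t y B c \<in> vecs ?d" by (simp add: plane_point_def vecs_def)
      ultimately show "c \<in> {c \<in> vecs 2. plane_point t y B c \<in> K (stack t B p)}"
        using c by (simp add: K_def rich_def)
    qed
    then have "card (rich L U y) \<le> card {c \<in> vecs 2. plane_point t y B c \<in> K (stack t B p)}"
      by (intro card_mono) auto
    then have "(1 - \<eta>) * q\<^sup>2 \<le> card {c \<in> vecs 2. plane_point t y B c \<in> K (stack t B p)}"
      using LU(4) by linarith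
    then show ?thesis using B by (auto simp: G_def)
  qed
  have "card W \<le> card {M \<in> mats ?d n. B \<in> G M}" if B: "B \<in> mats t 2" for B
  proof (rule card_inj_on_le)
    show "inj_on (stack t B) W" using inj_on_stack W_sub by (rule inj_on_subset)
    show "stack t B ` W \<subseteq> {M \<in> mats ?d n. B \<in> G M}"
      using stack_G[OF _ B] W_sub stack_in_mats by fastforce
  qed simp
  then have "(\<Sum>B\<in>(mats t 2 :: (nat \<Rightarrow> nat \<Rightarrow> 'a) set). card W)
      \<le> (\<Sum>B\<in>mats t 2. card {M \<in> mats ?d n. B \<in> G M})"
    by (intro sum_mono)
  also have "\<dots> = (\<Sum>B\<in>mats t 2. \<Sum>M\<in>mats ?d n. if B \<in> G M then 1 else 0)"
    by (simp add: sum.If_cases Int_def)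
  also have "\<dots> = (\<Sum>M\<in>mats ?d n. \<Sum>B\<in>mats t 2. if B \<in> G M then 1 else 0)" by (rule sum.swap)
  also have "\<dots> = (\<Sum>M\<in>mats ?d n. card (G M))"
  proof (rule sum.cong[OF refl])
    fix M
    have "mats t 2 \<inter> G M = G M" by (auto simp: G_def)
    then show "(\<Sum>B\<in>mats t 2. if B \<in> G M then 1 else 0) = card (G M)" by (simp add: sum.If_cases)
  qed
  finally have "real (\<Sum>B\<in>(mats t 2 :: (nat \<Rightarrow> nat \<Rightarrow> 'a) set). card W) \<le> real (\<Sum>M\<in>mats ?d n. card (G M))"
    by (simp only: of_nat_le_iff)
  then have G_sum: "q ^ (2 * t) * card W \<le> (\<Sum>M\<in>mats ?d n. real (card (G M)))"
    by (simp add: card_mats q_def mult.commute)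

  have "real (card (G M)) * q ^ ?d \<le> 60 * real (card (K M)) * q ^ (2 * t)" for M
    unfolding q_def
  proof (rule kakeya_planes[where \<eta> = \<eta>])
    show "finite (K M)" by (simp add: K_def)
    show "0 \<le> \<eta>" using \<eta> by simp
    have "(t + 2) * \<eta> = real (t + 2) / n * (2 * \<delta>\<^sup>2)" by (simp add: \<eta>_def)
    also have "\<dots> \<le> 1 * (2 * (1 / 10)\<^sup>2)"
      using assms n by (intro mult_mono power_mono) auto
    finally show "(real t + 2) * \<eta> \<le> 1 / 50" by (simp add: power2_eq_square add.commute)
    show "t + 2 \<le> card (UNIV :: 'a set)" using assms(8,9) unfolding q_def by linarith
  qed (auto simp: G_def q_def)
  then have "(\<Sum>M\<in>mats ?d n. real (card (G M)) * q ^ ?d)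
      \<le> (\<Sum>M\<in>mats ?d n. 60 * real (card (K M)) * q ^ (2 * t))"
    by (intro sum_mono)
  then have K_sum: "(\<Sum>M\<in>mats ?d n. real (card (G M))) * q ^ ?d
      \<le> 60 * q ^ (2 * t) * (\<Sum>M\<in>mats ?d n. real (card (K M)))"
    by (simp add: sum_distrib_left sum_distrib_right mult_ac)

  have "\<tau> * s * (\<Sum>M\<in>mats ?d n. real (card (K M))) \<le> q ^ (2 * ?d) * q ^ (?d * n)"
    using sum_card_rich_le[OF S(1) \<open>S \<noteq> {}\<close>, of \<sigma> ?d] \<sigma>
    unfolding K_def \<theta>_def s_def q_def by simp
  note K_le = this

  define k where "k = (\<Sum>M\<in>mats ?d n. real (card (K M)))"
  \<comment> \<open>The constant 120 is the Kakeya constant 60 times 2, the latter for the half of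
    all \<open>U\<close> in \<open>card_W\<close>.\<close>
  have "q ^ (2 * t) * (card bad * q ^ (2 * n) * q ^ ?d) \<le> q ^ (2 * t) * (2 * card W * q ^ ?d)"
    using card_W q by (intro mult_left_mono mult_right_mono) auto
  also have "\<dots> = 2 * (q ^ (2 * t) * card W * q ^ ?d)" by simp
  also have "\<dots> \<le> 2 * ((\<Sum>M\<in>mats ?d n. real (card (G M))) * q ^ ?d)"
    using G_sum q by (intro mult_left_mono mult_right_mono) auto
  also have "\<dots> \<le> 2 * (60 * q ^ (2 * t) * k)" unfolding k_def using K_sum by (rule mult_left_mono) simp
  also have "\<dots> = q ^ (2 * t) * (120 * k)" by simp
  finally have 1: "card bad * q ^ (2 * n) * q ^ ?d \<le> 120 * k" using q by (simp add: mult_le_cancel_left)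
  have "q ^ (2 * n) * q ^ ?d * (\<tau> * s * card bad) = \<tau> * s * (card bad * q ^ (2 * n) * q ^ ?d)" by simp
  also have "\<dots> \<le> \<tau> * s * (120 * k)" using 1 s assms by (intro mult_left_mono) auto
  also have "\<dots> = 120 * (\<tau> * s * k)" by simp
  also have "\<dots> \<le> 120 * (q ^ (2 * ?d) * q ^ (?d * n))" using K_le by (simp add: k_def)
  also have "\<dots> = q ^ (2 * n) * q ^ ?d * (120 * q ^ ?d * q ^ (t * n))"
    by (simp add: power_add power_mult power2_eq_square add_mult_distrib mult_ac)
  finally have "\<tau> * s * card bad \<le> 120 * q ^ ?d * q ^ (t * n)" using q by (simp add: mult_le_cancel_left)
  \<comment> \<open>Here the size of \<open>S\<close>, at least \<open>q\<close> times that of the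
    target space of dimension \<open>t + 2\<close>, gains the decisive factor
    \<open>q\<close>.\<close>
  moreover have "\<tau> * (q ^ ?d * q) * card bad \<le> \<tau> * s * card bad"
  proof -
    have "q ^ ?d * q = q ^ (t + 3)" by (simp add: power_add power3_eq_cube power2_eq_square)
    then show ?thesis using s assms(4) by (intro mult_right_mono mult_left_mono) auto
  qed
  ultimately have "q ^ ?d * (\<tau> * q * card bad) \<le> q ^ ?d * (120 * q ^ (t * n))" by (simp add: mult_ac)
  then have 2: "\<tau> * q * card bad \<le> 120 * q ^ (t * n)" using q by (simp add: mult_le_cancel_left)
  \<comment> \<open>Converts the bound \<open>120 / (\<tau> * q)\<close> on the proportion of bad
    maps into \<open>120 * \<delta>\<^sup>2 / n\<close>.\<close>
  have "n \<le> \<tau> * q * \<delta>\<^sup>2"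
  proof -
    have "(\<tau> - \<sigma>)\<^sup>2 = \<tau> * (\<sigma> - 1)\<^sup>2"
      unfolding \<sigma>(2)[symmetric] by (simp add: power2_eq_square algebra_simps)
    moreover have "(\<sigma> - 1)\<^sup>2 \<le> 1 + \<tau>" using \<sigma> by (simp add: power2_diff)
    ultimately have "(\<tau> - \<sigma>)\<^sup>2 \<le> \<tau> * (1 + \<tau>)" using assms by simp
    then have "q * ((\<tau> - \<sigma>)\<^sup>2 * \<delta>\<^sup>2) \<le> q * (\<tau> * (1 + \<tau>) * \<delta>\<^sup>2)"
      using q by (intro mult_left_mono mult_right_mono) auto
    then have "n * (1 + \<tau>) \<le> (\<tau> * q * \<delta>\<^sup>2) * (1 + \<tau>)"
      using q_ge by (simp add: \<sigma>_def mult_ac)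
    then show ?thesis using assms by (simp add: mult_le_cancel_right)
  qed
  then have "n * real (card bad) \<le> \<tau> * q * \<delta>\<^sup>2 * card bad" by (intro mult_right_mono) auto
  also have "\<dots> = \<delta>\<^sup>2 * (\<tau> * q * card bad)" by simp
  also have "\<dots> \<le> \<delta>\<^sup>2 * (120 * q ^ (t * n))" using 2 by (intro mult_left_mono) auto
  finally show ?thesis by (simp add: bad_def s_def)
qed

section \<open>From all linear maps to the surjective ones\<close>

theorem mainTheorem5:
  fixes S :: "(nat \<Rightarrow> 'a::{finite,field}) set"
    and n r :: nat and \<tau> \<delta> :: real
  assumes "n \<ge> 20"
    and "S \<subseteq> vecs n"
    and "\<tau> > 1" and "0 < \<delta>" and "\<delta> < 1/10"
    and "real (card (UNIV :: 'a set)) \<ge> max (real n * (1 + \<tau>) / ((\<tau> - sqrt \<tau>)^2 * \<delta>^2)) (real n)"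
    and "real (card (UNIV :: 'a set)) ^ r < real (card S)" and "real (card S) \<le> real (card (UNIV :: 'a set)) ^ (r + 1)"
    and "4 \<le> r" and "r \<le> n - 1"
  shows "real (card {L \<in> surj_lin_maps (r - 3) n.
            linf_close_unif (push_unif S (mat_apply (r - 3) n L)) (vecs (r - 3))
              (\<tau> / real (card (UNIV :: 'a set)) ^ (r - 3))})
         \<ge> (1 - \<delta>) * real (card (surj_lin_maps (r - 3) n :: (nat \<Rightarrow> nat \<Rightarrow> 'a) set))"
proof -
  define q where "q = real (card (UNIV :: 'a set))"
  define t where "t = r - 3"
  have t: "r = t + 3" "t + 4 \<le> n" using assms by (auto simp: t_def)
  have q: "20 \<le> q" "n \<le> q" using assms by (auto simp: q_def)
  have S: "q ^ (t + 3) < card S" using assms(7) by (simp add: q_def t)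
  then have s: "0 < card S" using q by (smt (verit) of_nat_0_less_iff zero_less_power)
  define surj where "surj = (surj_lin_maps t n :: (nat \<Rightarrow> nat \<Rightarrow> 'a) set)"
  define close where "close L \<longleftrightarrow> linf_close_unif (push_unif S (mat_apply t n L)) (vecs t) (\<tau> / q ^ t)" for L
  define bad where "bad = {L \<in> mats t n. \<exists>y\<in>vecs t.
      (1 + \<tau>) * (card S / q ^ t) \<le> card {x \<in> S. mat_apply t n L x = y}}"
  have surj_sub: "surj \<subseteq> mats t n" by (auto simp: surj_def surj_lin_maps_def)
  have fin: "finite surj" using surj_sub finite_subset[OF _ finite_mats] by blast
  have sqrt_less: "sqrt \<tau> < \<tau>" by (rule real_less_lsqrt) (use assms(3) in \<open>auto simp: power2_eq_square\<close>)
  have "n * (1 + \<tau>) / ((\<tau> - sqrt \<tau>)\<^sup>2 * \<delta>\<^sup>2) \<le> q" using assms(6) by (simp add: q_def)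
  then have q_ge: "n * (1 + \<tau>) \<le> q * ((\<tau> - sqrt \<tau>)\<^sup>2 * \<delta>\<^sup>2)"
    using sqrt_less assms(4) by (simp add: pos_divide_le_eq)
  have bad: "n * real (card bad) \<le> 120 * \<delta>\<^sup>2 * q ^ (t * n)"
    unfolding bad_def q_def
    by (rule card_heavy_fiber_maps_le) (use assms S q q_ge t in \<open>auto simp: q_def\<close>)
  \<comment> \<open>\<open>n \<ge> 20\<close> and \<open>\<delta> < 1 / 10\<close> reduce the
    proportion \<open>120 * \<delta>\<^sup>2 / n\<close> to
    \<open>6 / 10 * \<delta>\<close>.\<close>
  have "20 * real (card bad) \<le> n * real (card bad)" using assms(1) by (intro mult_right_mono) auto
  then have "card bad \<le> 6 * \<delta>\<^sup>2 * q ^ (t * n)" using bad by linarith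
  also have "\<dots> \<le> \<delta> * (6 / 10) * q ^ (t * n)"
    using assms(4,5) q by (intro mult_right_mono) (auto simp: power2_eq_square)
  finally have bad': "card bad \<le> \<delta> * (6 / 10 * q ^ (t * n))" by simp
  \<comment> \<open>Since \<open>q ^ (n - t) \<ge> 20\<close>, at most one tenth of all maps are not
    surjective. The slack between \<open>6 / 10\<close> and \<open>9 / 10\<close> absorbs the
    passage to surjective maps.\<close>
  have "real (card (mats t n - surj)) * q ^ (n - t) \<le> 2 * q ^ (t * n)"
    unfolding surj_def q_def using card_not_surjective_le[of t n, where 'a = 'a] t by simp
  moreover have "20 \<le> q ^ (n - t)"
  proof -
    have "q ^ 1 \<le> q ^ (n - t)" using q t by (intro power_increasing) auto
    then show ?thesis using q by simp
  qed
  then have "real (card (mats t n - surj)) * 20 \<le> real (card (mats t n - surj)) * q ^ (n - t)"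
    by (intro mult_left_mono) auto
  ultimately have "real (card (mats t n - surj)) \<le> q ^ (t * n) / 10" by linarith
  moreover have "card (mats t n - surj) = card (mats t n :: (nat \<Rightarrow> nat \<Rightarrow> 'a) set) - card surj"
    using surj_sub fin by (intro card_Diff_subset)
  moreover have "card surj \<le> card (mats t n :: (nat \<Rightarrow> nat \<Rightarrow> 'a) set)"
    using surj_sub by (intro card_mono) auto
  ultimately have "9 / 10 * q ^ (t * n) \<le> card surj"
    by (simp add: card_mats q_def of_nat_diff)
  moreover have "0 \<le> q ^ (t * n)" using q by simp
  ultimately have "6 / 10 * q ^ (t * n) \<le> card surj" by linarith
  then have bad_le: "card bad \<le> \<delta> * card surj"
    using bad' mult_left_mono[of "6 / 10 * q ^ (t * n)" "card surj" \<delta>] assms(4) by linarith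
  have "L \<in> bad" if L: "L \<in> surj" "\<not> close L" for L
  proof -
    obtain y where y: "y \<in> vecs t"
      "\<tau> / q ^ t < \<bar>push_unif S (mat_apply t n L) y - 1 / real (card (vecs t :: (nat \<Rightarrow> 'a) set))\<bar>"
      using L(2) unfolding close_def linf_close_unif_def by (auto simp: not_le)
    \<comment> \<open>A probability is nonnegative, so a downward deviation is at most
      \<open>1 / q ^ t\<close> and within the tolerance. The deviation must be upward, which gives a
      heavy fibre.\<close>
    have "1 / q ^ t \<le> \<tau> / q ^ t" using assms(3) q by (intro divide_right_mono) auto
    moreover have "0 \<le> push_unif S (mat_apply t n L) y" by (simp add: push_unif_def)
    moreover have "real (card (vecs t :: (nat \<Rightarrow> 'a) set)) = q ^ t" by (simp add: card_vecs q_def)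
    ultimately have "1 / q ^ t + \<tau> / q ^ t < push_unif S (mat_apply t n L) y"
      using y(2) by (simp only:)
    then have "(1 + \<tau>) / q ^ t < card {x \<in> S. mat_apply t n L x = y} / card S"
      by (simp add: push_unif_def add_divide_distrib)
    then have "(1 + \<tau>) * (card S / q ^ t) \<le> card {x \<in> S. mat_apply t n L x = y}"
      using s by (simp add: pos_less_divide_eq)
    then show ?thesis using y(1) L(1) surj_sub by (auto simp: bad_def)
  qed
  then have "card (surj - {L \<in> surj. close L}) \<le> card bad"
    by (intro card_mono) (auto simp: bad_def)
  moreover have "card (surj - {L \<in> surj. close L}) = card surj - card {L \<in> surj. close L}"
    using fin by (intro card_Diff_subset) auto
  moreover have "card {L \<in> surj. close L} \<le> card surj" using fin by (intro card_mono) auto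
  ultimately have "real (card surj) - card {L \<in> surj. close L} \<le> card bad" by linarith
  then have "(1 - \<delta>) * card surj \<le> card {L \<in> surj. close L}"
    using bad_le by (simp add: left_diff_distrib)
  then show ?thesis unfolding surj_def close_def q_def t_def .
qed

end
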